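(* $NPO(5)=16$.
   Context: All graphs are finite, simple and undirected; $A(G)$ denotes the adjacency matrix of $G$. Eigenvalues are counted with multiplicity. For a positive integer $k$, $NPO(k)$ is the smallest integer $n$ such that the adjacency matrix of every graph with at least $n$ vertices has at least $k$ nonpositive eigenvalues. *)

theory Defs
  imports "Jordan_Normal_Form.Char_Poly"
begin

definition simple_graph :: "nat \<Rightarrow> (nat \<Rightarrow> nat \<Rightarrow> bool) \<Rightarrow> bool" where
  "simple_graph n E \<longleftrightarrow> (\<forall>i<n. \<forall>j<n. E i j = E j i) \<and> (\<forall>i<n. \<not> E i i)"

definition adj_mat :: "nat \<Rightarrow> (nat \<Rightarrow> nat \<Rightarrow> bool) \<Rightarrow> real mat" where
  "adj_mat n E = mat n n (\<lambda>(i, j). if E i j then 1 else 0)"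

text \<open>Number of nonpositive eigenvalues counted with (algebraic) multiplicity,
  i.e. nonpositive real roots of the characteristic polynomial with their orders.
  (A(G) is real symmetric, so all eigenvalues are real.)\<close>
definition num_nonpos_eigs :: "real mat \<Rightarrow> nat" where
  "num_nonpos_eigs A = (\<Sum>x\<in>{x. poly (char_poly A) x = 0 \<and> x \<le> 0}. order x (char_poly A))"

definition NPO :: "nat \<Rightarrow> nat" where
  "NPO k = (LEAST n. \<forall>m\<ge>n. \<forall>E. simple_graph m E \<longrightarrow> k \<le> num_nonpos_eigs (adj_mat m E))"

end

theory Submission
  imports Defs "Jordan_Normal_Form.Schur_Decomposition"
begin

text \<open>
  A real symmetric matrix has at most \<open>m\<close> nonpositive eigenvalues iff its quadratic form is
  positive definite on the common kernel of some \<open>m\<close> linear functionals; hence at most four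
  nonpositive eigenvalues means that no five-dimensional space of vectors is nonpositive.

  Lower bound: take a 5-clique together with its ten pairs of vertices, where a pair is joined to its
  two elements and to the pairs disjoint from it. The clique contributes four negative directions, and
  the ten pairs become orthonormal after projecting away the clique.

  Upper bound: let \<open>I\<close> be a largest independent set among 16 vertices. Vectors off \<open>I\<close> that are
  orthogonal to \<open>I\<close> carry a form with at most \<open>4 - |I|\<close> nonpositive directions.
  If \<open>|I| = 4\<close>, the remaining vertices have pairwise distinct neighbourhoods in \<open>I\<close>, so at most three
  nonempty subsets of \<open>I\<close> are not neighbourhoods. Positivity on \<open>x + y - z - w\<close> for parallelograms of
  neighbourhoods all but determines the graph on a parallelepiped of neighbourhoods, and every choice
  of the missing subsets leaves a contradictory parallelepiped.
  If \<open>|I| = 3\<close>, differences of vertices with equal neighbourhoods in \<open>I\<close> leave room for at most 12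
  further vertices. If \<open>|I| \<le> 2\<close>, there is a 5-clique, and projecting it away shows that at most ten
  further vertices fit.
\<close>

subsection \<open>Nonpositive eigenvalues and positive definiteness on kernels\<close>

text \<open>Gaussian elimination by induction on the equations: an equation with a nonzero
  coefficient at \<open>p\<close> is solved for the unknown \<open>p\<close>, which costs one
  equation and one unknown.\<close>

lemma homogeneous_system_nontrivial:
  fixes f :: "'k \<Rightarrow> 'j \<Rightarrow> real"
  assumes "finite K" "finite J" "card K < card J"
  shows "\<exists>c. (\<exists>j\<in>J. c j \<noteq> 0) \<and> (\<forall>k\<in>K. (\<Sum>j\<in>J. f k j * c j) = 0)"
  using assms
proof (induction K arbitrary: J f rule: finite_induct)
  case empty
  then obtain j where "j \<in> J" by fastforce
  then show ?case by (intro exI[of _ "\<lambda>_. 1"]) auto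
next
  case (insert k K)
  show ?case
  proof (cases "\<forall>j\<in>J. f k j = 0")
    case True
    from insert.IH[of J f] insert.prems insert.hyps
    obtain c where c: "\<exists>j\<in>J. c j \<noteq> 0" "\<forall>k\<in>K. (\<Sum>j\<in>J. f k j * c j) = 0" by auto
    with True show ?thesis by (intro exI[of _ c]) auto
  next
    case False
    then obtain p where p: "p \<in> J" "f k p \<noteq> 0" by auto
    define J' where "J' = J - {p}"
    have fin: "finite J'" and p': "p \<notin> J'" and J: "J = insert p J'"
      using insert.prems p by (auto simp: J'_def)
    have "card K < card J'" using insert.prems insert.hyps p by (auto simp: J'_def)
    \<comment> \<open>These are the coefficients after subtracting the multiple of row
      \<open>k\<close> that clears column \<open>p\<close>.\<close>
    from insert.IH[OF fin this, of "\<lambda>k' j. f k' j - f k' p * f k j / f k p"]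
    obtain c where c: "\<exists>j\<in>J'. c j \<noteq> 0"
      "\<forall>k'\<in>K. (\<Sum>j\<in>J'. (f k' j - f k' p * f k j / f k p) * c j) = 0" by auto
    define s where "s = (\<Sum>j\<in>J'. f k j * c j)"
    define c' where "c' = c(p := - s / f k p)"
    have sum_c': "(\<Sum>j\<in>J. g j * c' j) = (\<Sum>j\<in>J'. g j * c j) - g p * s / f k p" for g
    proof -
      have "(\<Sum>j\<in>J'. g j * c' j) = (\<Sum>j\<in>J'. g j * c j)"
        using p' by (intro sum.cong) (auto simp: c'_def)
      then show ?thesis using fin p' by (simp add: J c'_def)
    qed
    have "(\<Sum>j\<in>J. f k' j * c' j) = 0" if "k' \<in> K" for k'
    proof -
      have "0 = (\<Sum>j\<in>J'. f k' j * c j - f k' p / f k p * (f k j * c j))"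
        using c(2) that by (simp add: algebra_simps)
      also have "\<dots> = (\<Sum>j\<in>J'. f k' j * c j) - f k' p / f k p * s"
        unfolding s_def by (simp add: sum_subtractf sum_distrib_left)
      finally show ?thesis by (simp add: sum_c')
    qed
    moreover have "(\<Sum>j\<in>J. f k j * c' j) = 0" using p by (simp add: sum_c' s_def)
    moreover have "\<exists>j\<in>J. c' j \<noteq> 0" using c(1) p' by (auto simp: J c'_def)
    ultimately show ?thesis by (intro exI[of _ c']) auto
  qed
qed

section \<open>The spectral theorem for real symmetric matrices, with multiplicities\<close>

lemma order_prod_linear:
  fixes d :: "nat \<Rightarrow> real"
  shows "Polynomial.order x (\<Prod>i<n. [:- d i, 1:]) = card {i. i < n \<and> d i = x}"
proof (induction n)
  case (Suc n)
  have "Polynomial.order x (\<Prod>i<Suc n. [:- d i, 1:]) = card {i. i < n \<and> d i = x} + (if d n = x then 1 else 0)"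
    using Suc order_mult[of "\<Prod>i<n. [:- d i, 1:]" "[:- d n, 1:]" x]
    by (auto simp: order_linear' prod_zero_iff simp del: mult_pCons_right mult_pCons_left)
  also have "{i. i < Suc n \<and> d i = x} = {i. i < n \<and> d i = x} \<union> (if d n = x then {n} else {})"
    by (auto simp: less_Suc_eq)
  ultimately show ?case by (auto simp: less_Suc_eq)
qed (simp add: order_1_eq_0)

text \<open>The fundamental theorem of algebra gives a complex eigenvector \<open>x + i y\<close>.
  Symmetry makes its eigenvalue real, and then whichever of \<open>x\<close> and \<open>y\<close> is
  nonzero is a real eigenvector.\<close>

lemma real_symmetric_eigenvector:
  fixes A :: "real mat"
  assumes A: "A \<in> carrier_mat n n" and sym: "transpose_mat A = A" and n: "n > 0"
  shows "\<exists>v e. v \<in> carrier_vec n \<and> v \<noteq> 0\<^sub>v n \<and> A *\<^sub>v v = e \<cdot>\<^sub>v v"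
proof -
  define C where "C = map_mat complex_of_real A"
  have C: "C \<in> carrier_mat n n" using A by (auto simp: C_def)
  have "degree (char_poly C) = n" using degree_monic_char_poly[OF C] by simp
  then have "\<not> constant (poly (char_poly C))" using n by (simp add: constant_degree)
  from fundamental_theorem_of_algebra[OF this] obtain l where "poly (char_poly C) l = 0" by auto
  then have "eigenvalue C l" using eigenvalue_root_char_poly[OF C] by simp
  then obtain z where z: "z \<in> carrier_vec n" "z \<noteq> 0\<^sub>v n" "C *\<^sub>v z = l \<cdot>\<^sub>v z"
    using C by (auto simp: eigenvalue_def eigenvector_def)
  define x where "x = map_vec Re z"
  define y where "y = map_vec Im z"
  have x: "x \<in> carrier_vec n" and y: "y \<in> carrier_vec n" using z by (auto simp: x_def y_def)
  have entry: "(\<Sum>j<n. complex_of_real (A $$ (i,j)) * z $ j) = l * z $ i" if "i < n" for i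
  proof -
    have "(C *\<^sub>v z) $ i = l * z $ i" using z that by simp
    then show ?thesis using that z(1) A C
      by (simp add: scalar_prod_def C_def atLeast0LessThan)
  qed
  have Ax: "A *\<^sub>v x = Re l \<cdot>\<^sub>v x - Im l \<cdot>\<^sub>v y"
  proof (rule eq_vecI)
    fix i assume "i < dim_vec (Re l \<cdot>\<^sub>v x - Im l \<cdot>\<^sub>v y)"
    then have i: "i < n" using y by simp
    from arg_cong[OF entry[OF i], of Re]
    show "(A *\<^sub>v x) $ i = (Re l \<cdot>\<^sub>v x - Im l \<cdot>\<^sub>v y) $ i"
      using i A z by (simp add: scalar_prod_def atLeast0LessThan x_def y_def)
  qed (use A y in auto)
  have Ay: "A *\<^sub>v y = Re l \<cdot>\<^sub>v y + Im l \<cdot>\<^sub>v x"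
  proof (rule eq_vecI)
    fix i assume "i < dim_vec (Re l \<cdot>\<^sub>v y + Im l \<cdot>\<^sub>v x)"
    then have i: "i < n" using x by simp
    from arg_cong[OF entry[OF i], of Im]
    show "(A *\<^sub>v y) $ i = (Re l \<cdot>\<^sub>v y + Im l \<cdot>\<^sub>v x) $ i"
      using i A z by (simp add: scalar_prod_def atLeast0LessThan x_def y_def)
  qed (use A x in auto)
  \<comment> \<open>Expanding both sides, the terms with the real part of \<open>l\<close> cancel
    and the imaginary part times the sum of the squared norms remains.\<close>
  have "x \<bullet> (A *\<^sub>v y) = (A *\<^sub>v x) \<bullet> y"
    using transpose_vec_mult_scalar[OF A y x] sym x y A
    by (simp add: sym)
  then have "Im l * (x \<bullet> x + y \<bullet> y) = 0"
    unfolding Ax Ay using x y comm_scalar_prod[OF x y]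
    by (simp add: scalar_prod_add_distrib[of _ n] minus_scalar_prod_distrib[of _ n] algebra_simps)
  moreover have "x \<noteq> 0\<^sub>v n \<or> y \<noteq> 0\<^sub>v n"
  proof (rule ccontr)
    assume "\<not> ?thesis"
    then have "x $ i = 0 \<and> y $ i = 0" if "i < n" for i using that by simp
    then have "z $ i = 0" if "i < n" for i using that z(1) by (simp add: x_def y_def complex_eq_iff)
    then have "z = 0\<^sub>v n" using z(1) by (intro eq_vecI) auto
    with z show False by simp
  qed
  moreover have "x \<bullet> x \<ge> 0" "y \<bullet> y \<ge> 0" by (auto simp: scalar_prod_def intro!: sum_nonneg)
  moreover have "v \<bullet> v = 0 \<Longrightarrow> v = 0\<^sub>v n" if "v \<in> carrier_vec n" for v :: "real vec"
    using conjugate_square_eq_0_vec[OF that] by simp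
  ultimately have "Im l = 0" using x y by (smt (verit) mult_eq_0_iff)
  then have "A *\<^sub>v x = Re l \<cdot>\<^sub>v x" "A *\<^sub>v y = Re l \<cdot>\<^sub>v y" unfolding Ax Ay using x y by auto
  then show ?thesis using x y \<open>x \<noteq> 0\<^sub>v n \<or> y \<noteq> 0\<^sub>v n\<close> by blast
qed

text \<open>Gram-Schmidt on a basis that starts with \<open>v\<close> keeps \<open>v\<close> as
  first vector, and normalising only rescales it by \<open>c\<close>.\<close>

lemma orthogonal_completion:
  fixes v :: "real vec"
  assumes v: "v \<in> carrier_vec n" and v0: "v \<noteq> 0\<^sub>v n" and n: "n > 0"
  shows "\<exists>W c. W \<in> carrier_mat n n \<and> transpose_mat W * W = 1\<^sub>m n \<and> col W 0 = c \<cdot>\<^sub>v v"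
proof -
  interpret cof_vec_space n "TYPE(real)" .
  define ws where "ws = gram_schmidt n (basis_completion v)"
  note bc = basis_completion[OF v v0]
  note gs = gram_schmidt_result[OF bc(2,4,5) ws_def]
  have len: "length ws = n" using gs(4) bc(6) by simp
  have dim: "ws ! i \<in> carrier_vec n" if "i < n" for i using gs(3) len that nth_mem by blast
  have hd: "ws ! 0 = v"
  proof -
    have "basis_completion v = v # tl (basis_completion v)"
      using bc(6,7) n by (metis length_0_conv list.collapse not_less_zero)
    then have "hd ws = v" unfolding ws_def using gram_schmidt_hd[OF v] by metis
    then show ?thesis using len n by (metis hd_conv_nth length_0_conv not_less_zero)
  qed
  have orth: "(ws ! i \<bullet> ws ! j = 0) = (i \<noteq> j)" if "i < n" "j < n" for i j
    using corthogonalD[OF gs(2), of i j] that len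
    by (simp add: conjugate_vec_def vec_eq_iff)
  \<comment> \<open>No norm vanishes here: this is \<open>orth\<close> for equal indices.\<close>
  define s where "s i = 1 / sqrt (ws ! i \<bullet> ws ! i)" for i
  define W where "W = mat_of_cols n (map (\<lambda>i. s i \<cdot>\<^sub>v ws ! i) [0..<n])"
  have W: "W \<in> carrier_mat n n" using mat_of_cols_carrier(1)[of n "map (\<lambda>i. s i \<cdot>\<^sub>v ws ! i) [0..<n]"]
    by (simp add: W_def del: mat_of_cols_carrier)
  have colW: "col W i = s i \<cdot>\<^sub>v ws ! i" if "i < n" for i
    using that dim by (simp add: W_def)
  have "transpose_mat W * W = 1\<^sub>m n"
  proof (rule eq_matI)
    fix i j assume "i < dim_row (1\<^sub>m n :: real mat)" "j < dim_col (1\<^sub>m n :: real mat)"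
    then have ij: "i < n" "j < n" by auto
    have "(transpose_mat W * W) $$ (i, j) = s i * (s j * (ws ! i \<bullet> ws ! j))"
      using ij W dim[OF ij(1)] dim[OF ij(2)]
      by (simp add: colW smult_scalar_prod_distrib[of _ n] scalar_prod_smult_distrib[of _ n])
    also have "\<dots> = (if i = j then 1 else 0)"
    proof (cases "i = j")
      case True
      have "ws ! i \<bullet> ws ! i \<ge> 0" by (auto simp: scalar_prod_def intro!: sum_nonneg)
      then show ?thesis using True orth[OF ij]
        by (auto simp: s_def field_simps)
    qed (use orth[OF ij] in auto)
    finally show "(transpose_mat W * W) $$ (i, j) = 1\<^sub>m n $$ (i, j)" using ij by simp
  qed (use W in auto)
  moreover have "col W 0 = s 0 \<cdot>\<^sub>v v" using colW[OF n] hd by simp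
  ultimately show ?thesis using W by blast
qed

text \<open>Deflation: in an orthonormal basis that starts with an eigenvector, the first column of
  the matrix is a multiple of the first unit vector. Symmetry clears the first row as well, and
  induction applies to the remaining block \<open>B3\<close>.\<close>

lemma real_symmetric_diagonalizable:
  fixes A :: "real mat"
  assumes "A \<in> carrier_mat n n" "transpose_mat A = A"
  shows "\<exists>P d. P \<in> carrier_mat n n \<and> transpose_mat P * P = 1\<^sub>m n \<and>
    transpose_mat P * A * P = mat n n (\<lambda>(i, j). if i = j then d i else 0)"
  using assms
proof (induction n arbitrary: A)
  case 0
  then show ?case
    by (intro exI[of _ "1\<^sub>m 0"] exI[of _ "\<lambda>_. 0"]) (auto intro!: eq_matI)
next
  case (Suc m)
  let ?n = "Suc m"
  note A = Suc.prems(1) and sym = Suc.prems(2)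
  obtain v e where v: "v \<in> carrier_vec ?n" "v \<noteq> 0\<^sub>v ?n" "A *\<^sub>v v = e \<cdot>\<^sub>v v"
    using real_symmetric_eigenvector[OF A sym] by auto
  obtain W c where W: "W \<in> carrier_mat ?n ?n" "transpose_mat W * W = 1\<^sub>m ?n" "col W 0 = c \<cdot>\<^sub>v v"
    using orthogonal_completion[OF v(1,2)] by auto
  have WT: "transpose_mat W \<in> carrier_mat ?n ?n" using W by simp
  define B where "B = transpose_mat W * A * W"
  have B: "B \<in> carrier_mat ?n ?n" using A W by (simp add: B_def)
  have symB: "transpose_mat B = B"
    unfolding B_def using A W sym
    by (simp add: transpose_mult[of _ ?n ?n _ ?n] assoc_mult_mat[of _ ?n ?n _ ?n _ ?n])
  have "A *\<^sub>v col W 0 = e \<cdot>\<^sub>v col W 0" using v A by (simp add: W(3) mult_mat_vec[of A ?n ?n] smult_smult_assoc mult.commute)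
  then have "B $$ (i, 0) = (if i = 0 then e else 0)" if "i < ?n" for i
  proof -
    have "B = transpose_mat W * (A * W)" unfolding B_def using A W by (simp add: assoc_mult_mat[of _ ?n ?n _ ?n _ ?n])
    then have "B $$ (i, 0) = col W i \<bullet> col (A * W) 0" using A W that by simp
    also have "col (A * W) 0 = A *\<^sub>v col W 0" by (rule col_mult2[OF A W(1)]) simp
    also have "\<dots> = e \<cdot>\<^sub>v col W 0" by fact
    also have "col W i \<bullet> \<dots> = e * (transpose_mat W * W) $$ (i, 0)" using W(1) that by simp
    finally show ?thesis using that unfolding W(2) by simp
  qed
  then have B0: "B $$ (i, 0) = (if i = 0 then e else 0)" "B $$ (0, i) = (if i = 0 then e else 0)"
    if "i < ?n" for i
    using that arg_cong[OF symB, of "\<lambda>M. M $$ (i, 0)"] B by auto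
  define B3 where "B3 = mat m m (\<lambda>(i, j). B $$ (Suc i, Suc j))"
  have B3: "B3 \<in> carrier_mat m m" by (simp add: B3_def)
  have "transpose_mat B3 = B3"
  proof (rule eq_matI)
    fix i j assume "i < dim_row B3" "j < dim_col B3"
    then show "transpose_mat B3 $$ (i, j) = B3 $$ (i, j)"
      using arg_cong[OF symB, of "\<lambda>M. M $$ (Suc i, Suc j)"] B by (simp add: B3_def)
  qed (auto simp: B3_def)
  from Suc.IH[OF B3 this] obtain P3 d3 where P3: "P3 \<in> carrier_mat m m" "transpose_mat P3 * P3 = 1\<^sub>m m"
    "transpose_mat P3 * B3 * P3 = mat m m (\<lambda>(i, j). if i = j then d3 i else 0)" by auto
  let ?E = "mat 1 1 (\<lambda>_. e)" and ?Zr = "0\<^sub>m 1 m :: real mat" and ?Zc = "0\<^sub>m m 1 :: real mat"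
  have blockB: "B = four_block_mat ?E ?Zr ?Zc B3"
  proof (rule eq_matI)
    fix i j assume "i < dim_row (four_block_mat ?E ?Zr ?Zc B3)" "j < dim_col (four_block_mat ?E ?Zr ?Zc B3)"
    then have "i < ?n" "j < ?n" by (auto simp: B3_def)
    then show "B $$ (i, j) = four_block_mat ?E ?Zr ?Zc B3 $$ (i, j)"
      using B0[of i] B0[of j] by (cases i; cases j) (auto simp: B3_def)
  qed (use B in \<open>auto simp: B3_def\<close>)
  define P' where "P' = four_block_mat (1\<^sub>m 1) ?Zr ?Zc P3"
  have P': "P' \<in> carrier_mat ?n ?n" using four_block_carrier_mat[OF one_carrier_mat P3(1), of 1 ?Zr ?Zc] by (simp only: P'_def plus_1_eq_Suc)
  have P'T: "transpose_mat P' = four_block_mat (1\<^sub>m 1) ?Zr ?Zc (transpose_mat P3)"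
    unfolding P'_def
    by (subst transpose_four_block_mat[of _ 1 1 _ m _ m]) (use P3(1) in auto)
  have mult: "four_block_mat X ?Zr ?Zc Y * four_block_mat X' ?Zr ?Zc Y' = four_block_mat (X * X') ?Zr ?Zc (Y * Y')"
    if "X \<in> carrier_mat 1 1" "X' \<in> carrier_mat 1 1" "Y \<in> carrier_mat m m" "Y' \<in> carrier_mat m m" for X X' Y Y' :: "real mat"
    using that by (subst mult_four_block_mat[of _ 1 1 _ m _ m _ _ 1 _ m]) auto
  have orth': "transpose_mat P' * P' = 1\<^sub>m ?n"
    unfolding P'T unfolding P'_def using P3(1,2) by (subst mult) auto
  have diag': "transpose_mat P' * B * P' = mat ?n ?n (\<lambda>(i, j). if i = j then (case i of 0 \<Rightarrow> e | Suc k \<Rightarrow> d3 k) else 0)"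
    (is "_ = ?D")
  proof -
    have 1: "transpose_mat P' * B = four_block_mat (1\<^sub>m 1 * ?E) ?Zr ?Zc (transpose_mat P3 * B3)"
      unfolding P'T blockB by (rule mult) (use P3(1) B3 in auto)
    have "transpose_mat P' * B * P' = four_block_mat (1\<^sub>m 1 * ?E * 1\<^sub>m 1) ?Zr ?Zc (transpose_mat P3 * B3 * P3)"
      unfolding 1 unfolding P'_def by (rule mult) (use P3(1) B3 in auto)
    also have "1\<^sub>m 1 * ?E * 1\<^sub>m 1 = ?E" by (rule eq_matI) (auto simp: scalar_prod_def)
    also have "four_block_mat ?E ?Zr ?Zc (transpose_mat P3 * B3 * P3) = ?D"
      unfolding P3(3)
    proof (rule eq_matI)
      fix i j assume "i < dim_row ?D" "j < dim_col ?D"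
      then have "i < ?n" "j < ?n" by auto
      then show "four_block_mat ?E ?Zr ?Zc (mat m m (\<lambda>(i, j). if i = j then d3 i else 0)) $$ (i, j) = ?D $$ (i, j)"
        by (cases i; cases j) simp_all
    qed simp_all
    finally show ?thesis .
  qed
  define P where "P = W * P'"
  have P: "P \<in> carrier_mat ?n ?n" using W P' by (simp add: P_def)
  have PT: "transpose_mat P = transpose_mat P' * transpose_mat W"
    unfolding P_def by (rule transpose_mult[OF W(1) P'])
  have P'Tc: "transpose_mat P' \<in> carrier_mat ?n ?n" using P' by simp
  have "transpose_mat P * P = transpose_mat P' * (transpose_mat W * W) * P'"
    unfolding PT unfolding P_def using W(1) WT P' P'Tc
    by (simp add: assoc_mult_mat[of _ ?n ?n _ ?n _ ?n])
  then have "transpose_mat P * P = 1\<^sub>m ?n" using orth' P'Tc by (simp add: W(2))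
  moreover have "transpose_mat P * A * P = transpose_mat P' * B * P'"
    unfolding PT B_def unfolding P_def using W(1) WT P' P'Tc A
    by (simp add: assoc_mult_mat[of _ ?n ?n _ ?n _ ?n])
  ultimately show ?case using P diag'
    by (intro exI[of _ P] exI[of _ "case_nat e d3"] conjI) (simp_all only:)
qed

lemma real_symmetric_spectral:
  fixes A :: "real mat"
  assumes A: "A \<in> carrier_mat n n" and sym: "transpose_mat A = A"
  obtains u d :: "nat \<Rightarrow> _" where
    "\<And>i j. i < n \<Longrightarrow> j < n \<Longrightarrow> (\<Sum>k<n. u i k * u j k) = (if i = j then 1 else (0::real))"
    "\<And>k l. k < n \<Longrightarrow> l < n \<Longrightarrow> (\<Sum>i<n. u i k * u i l) = (if k = l then 1 else 0)"
    "\<And>k l. k < n \<Longrightarrow> l < n \<Longrightarrow> A $$ (k, l) = (\<Sum>i<n. d i * u i k * u i l)"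
    "num_nonpos_eigs A = card {i. i < n \<and> d i \<le> 0}"
proof -
  obtain P d where P: "P \<in> carrier_mat n n" "transpose_mat P * P = 1\<^sub>m n"
    and PAP: "transpose_mat P * A * P = mat n n (\<lambda>(i, j). if i = j then d i else (0::real))"
    using real_symmetric_diagonalizable[OF A sym] by blast
  define D where "D = mat n n (\<lambda>(i, j). if i = j then d i else (0::real))"
  have D: "D \<in> carrier_mat n n" by (simp add: D_def)
  have PT: "transpose_mat P \<in> carrier_mat n n" using P by simp
  \<comment> \<open>For square matrices a left inverse is a right inverse, so the rows of
    \<open>P\<close> are orthonormal too.\<close>
  have PPT: "P * transpose_mat P = 1\<^sub>m n" by (rule mat_mult_left_right_inverse[OF PT P])
  have "P * D * transpose_mat P = (P * transpose_mat P) * A * (P * transpose_mat P)"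
    unfolding D_def PAP[symmetric] using P(1) PT A by (simp add: assoc_mult_mat[of _ n n _ n _ n])
  then have A_eq: "A = P * D * transpose_mat P" using A by (simp add: PPT)
  have "similar_mat A D"
    unfolding similar_mat_def similar_mat_wit_def Let_def
    using A D P PT PPT A_eq by (intro exI[of _ P] exI[of _ "transpose_mat P"]) auto
  then have "char_poly A = char_poly D" by (rule char_poly_similar)
  also have "\<dots> = (\<Prod>a\<leftarrow>diag_mat D. [:- a, 1:])"
    by (rule char_poly_upper_triangular[OF D]) (auto simp: D_def)
  also have "diag_mat D = map d [0..<n]" by (auto simp: diag_mat_def D_def)
  also have "(\<Prod>a\<leftarrow>map d [0..<n]. [:- a, 1:]) = (\<Prod>i<n. [:- d i, 1:])"
    by (simp add: comp_def lessThan_atLeast0 prod.distinct_set_conv_list[symmetric])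
  finally have cp: "char_poly A = (\<Prod>i<n. [:- d i, 1:])" .
  have roots: "{x. poly (char_poly A) x = 0 \<and> x \<le> 0} = d ` {i. i < n \<and> d i \<le> 0}"
    by (auto simp: cp poly_prod)
  \<comment> \<open>The order of a root is the number of diagonal entries equal to it; summing over
    the roots regroups the nonpositive diagonal entries by value.\<close>
  have "num_nonpos_eigs A = (\<Sum>x\<in>d ` {i. i < n \<and> d i \<le> 0}. card {i. i < n \<and> d i = x})"
    unfolding num_nonpos_eigs_def roots by (simp add: cp order_prod_linear)
  also have "\<dots> = (\<Sum>x\<in>d ` {i. i < n \<and> d i \<le> 0}. \<Sum>i\<in>{i \<in> {i. i < n \<and> d i \<le> 0}. d i = x}. 1)"
    by (intro sum.cong) (auto intro!: arg_cong[of _ _ card])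
  also have "\<dots> = card {i. i < n \<and> d i \<le> 0}" by (subst sum.image_gen[symmetric]) auto
  finally have num: "num_nonpos_eigs A = card {i. i < n \<and> d i \<le> 0}" .
  show thesis
  proof (rule that[of "\<lambda>i k. P $$ (k, i)" d])
    fix i j assume ij: "i < n" "j < n"
    then show "(\<Sum>k<n. P $$ (k, i) * P $$ (k, j)) = (if i = j then 1 else 0)"
      using arg_cong[OF P(2), of "\<lambda>M. M $$ (i, j)"] P(1) by (simp add: scalar_prod_def lessThan_atLeast0)
    show "(\<Sum>k<n. P $$ (i, k) * P $$ (j, k)) = (if i = j then 1 else 0)"
      using arg_cong[OF PPT, of "\<lambda>M. M $$ (i, j)"] P(1) ij by (simp add: scalar_prod_def lessThan_atLeast0)
    have PD: "(P * D) $$ (i, k) = d k * P $$ (i, k)" if "k < n" for k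
    proof -
      have "(P * D) $$ (i, k) = (\<Sum>l<n. P $$ (i, l) * (if l = k then d l else 0))"
        using that ij P(1) by (simp add: scalar_prod_def lessThan_atLeast0 D_def)
      also have "\<dots> = (\<Sum>l<n. if l = k then d k * P $$ (i, k) else 0)"
        by (intro sum.cong) auto
      finally show ?thesis using that by simp
    qed
    show "A $$ (i, j) = (\<Sum>k<n. d k * P $$ (i, k) * P $$ (j, k))"
    proof -
      have "(M * transpose_mat P) $$ (i, j) = (\<Sum>k<n. M $$ (i, k) * P $$ (j, k))"
        if "M \<in> carrier_mat n n" for M
        using that ij P(1) by (simp add: scalar_prod_def lessThan_atLeast0)
      from this[of "P * D"] have "A $$ (i, j) = (\<Sum>k<n. (P * D) $$ (i, k) * P $$ (j, k))"
        using P(1) D A_eq by simp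
      then show ?thesis by (simp add: PD)
    qed
  qed (rule num)
qed

text \<open>In eigenvector coordinates the form is the sum of \<open>d i * (y x i)\<^sup>2\<close>.
  The coordinates with \<open>d i \<le> 0\<close> serve as functionals. Conversely, if more than
  \<open>m\<close> entries are nonpositive, the span of their eigenvectors meets every kernel of
  \<open>m\<close> functionals, and the form is nonpositive there.\<close>

lemma num_nonpos_eigs_le_iff:
  fixes A :: "real mat"
  assumes A: "A \<in> carrier_mat n n" and sym: "transpose_mat A = A"
  shows "num_nonpos_eigs A \<le> m \<longleftrightarrow> (\<exists>f. \<forall>x. (\<exists>i<n. x i \<noteq> 0) \<longrightarrow> (\<forall>k<m. (\<Sum>i<n. f k i * x i) = 0) \<longrightarrow>
    (\<Sum>k<n. \<Sum>l<n. A $$ (k, l) * x k * x l) > 0)"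
proof -
  obtain u d :: "nat \<Rightarrow> _" where
    u1: "\<And>i j. i < n \<Longrightarrow> j < n \<Longrightarrow> (\<Sum>k<n. u i k * u j k) = (if i = j then 1 else (0::real))"
    and u2: "\<And>k l. k < n \<Longrightarrow> l < n \<Longrightarrow> (\<Sum>i<n. u i k * u i l) = (if k = l then 1 else 0)"
    and A_eq: "\<And>k l. k < n \<Longrightarrow> l < n \<Longrightarrow> A $$ (k, l) = (\<Sum>i<n. d i * u i k * u i l)"
    and num: "num_nonpos_eigs A = card {i. i < n \<and> d i \<le> 0}"
    using real_symmetric_spectral[OF A sym] by blast
  define y where "y x i = (\<Sum>k<n. u i k * x k)" for x i
  have square: "(\<Sum>k<n. \<Sum>l<n. (\<Sum>i<n. c i * u i k * u i l) * x k * x l) = (\<Sum>i<n. c i * (y x i)\<^sup>2)" for c x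
  proof -
    have "(\<Sum>i<n. c i * (y x i)\<^sup>2) = (\<Sum>i<n. \<Sum>k<n. \<Sum>l<n. c i * u i k * u i l * x k * x l)"
      unfolding y_def power2_eq_square sum_product by (simp add: sum_distrib_left mult_ac)
    also have "\<dots> = (\<Sum>k<n. \<Sum>i<n. \<Sum>l<n. c i * u i k * u i l * x k * x l)" by (rule sum.swap)
    also have "\<dots> = (\<Sum>k<n. \<Sum>l<n. \<Sum>i<n. c i * u i k * u i l * x k * x l)"
      by (rule sum.cong[OF refl], rule sum.swap)
    finally show ?thesis by (simp add: sum_distrib_right)
  qed
  have form: "(\<Sum>k<n. \<Sum>l<n. A $$ (k, l) * x k * x l) = (\<Sum>i<n. d i * (y x i)\<^sup>2)" for x
    unfolding square[of d x, symmetric] by (intro sum.cong refl) (simp add: A_eq)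
  have parseval: "(\<Sum>i<n. (y x i)\<^sup>2) = (\<Sum>k<n. (x k)\<^sup>2)" for x
  proof -
    have "(\<Sum>i<n. (y x i)\<^sup>2) = (\<Sum>k<n. \<Sum>l<n. (\<Sum>i<n. u i k * u i l) * x k * x l)"
      using square[of "\<lambda>_. 1" x] by simp
    also have "\<dots> = (\<Sum>k<n. \<Sum>l<n. if l = k then (x k)\<^sup>2 else 0)"
      by (intro sum.cong refl) (auto simp: u2 power2_eq_square)
    finally show ?thesis by simp
  qed
  let ?N = "{i. i < n \<and> d i \<le> 0}"
  show ?thesis
  proof
    assume "num_nonpos_eigs A \<le> m"
    then have "card ?N \<le> card {..<m}" by (simp add: num)
    then obtain g where g: "inj_on g ?N" "g ` ?N \<subseteq> {..<m}" using card_le_inj[of ?N "{..<m}"] by auto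
    \<comment> \<open>The slot \<open>g i\<close> receives the functional of index \<open>i\<close>.
      Slots outside the image of \<open>g\<close> hold arbitrary functionals, which only shrink the
      kernel.\<close>
    define h where "h = the_inv_into ?N g"
    have h: "g i < m \<and> h (g i) = i" if "i \<in> ?N" for i
      using g that the_inv_into_f_f[OF g(1) that] by (auto simp: h_def)
    show "\<exists>f. \<forall>x. (\<exists>i<n. x i \<noteq> 0) \<longrightarrow> (\<forall>k<m. (\<Sum>i<n. f k i * x i) = 0) \<longrightarrow>
      (\<Sum>k<n. \<Sum>l<n. A $$ (k, l) * x k * x l) > 0"
    proof (intro exI[of _ "\<lambda>k. u (h k)"] allI impI)
      fix x :: "nat \<Rightarrow> real" assume x: "\<exists>i<n. x i \<noteq> 0" and "\<forall>k<m. (\<Sum>i<n. u (h k) i * x i) = 0"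
      then have zero: "y x i = 0" if "i \<in> ?N" for i using h[OF that] by (auto simp: y_def)
      from x obtain l where "l < n" "x l \<noteq> 0" by blast
      then have "(\<Sum>k<n. (x k)\<^sup>2) > 0" by (intro sum_pos2[of _ l]) auto
      then have sum_pos: "(\<Sum>i<n. (y x i)\<^sup>2) > 0" unfolding parseval[of x] .
      have "\<exists>i<n. y x i \<noteq> 0"
      proof (rule ccontr)
        assume "\<not> (\<exists>i<n. y x i \<noteq> 0)"
        then have "(\<Sum>i<n. (y x i)\<^sup>2) = 0" by (intro sum.neutral) simp
        with sum_pos show False by simp
      qed
      then obtain i where i: "i < n" "y x i \<noteq> 0" by (elim exE conjE)
      have pos: "d j > 0 \<or> y x j = 0" if "j < n" for j using zero[of j] that by (cases "d j \<le> 0") simp_all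
      have "d i * (y x i)\<^sup>2 > 0" using pos[OF i(1)] i(2) by simp
      moreover have "d j * (y x j)\<^sup>2 \<ge> 0" if "j \<in> {..<n}" for j using pos[of j] that by auto
      ultimately show "(\<Sum>k<n. \<Sum>l<n. A $$ (k, l) * x k * x l) > 0"
        unfolding form using i(1) by (intro sum_pos2[of _ i]) auto
    qed
  next
    assume "\<exists>f. \<forall>x. (\<exists>i<n. x i \<noteq> 0) \<longrightarrow> (\<forall>k<m. (\<Sum>i<n. f k i * x i) = 0) \<longrightarrow>
      (\<Sum>k<n. \<Sum>l<n. A $$ (k, l) * x k * x l) > 0"
    then obtain f where f: "\<And>x. (\<exists>i<n. x i \<noteq> 0) \<Longrightarrow> (\<forall>k<m. (\<Sum>i<n. f k i * x i) = 0) \<Longrightarrow>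
      (\<Sum>k<n. \<Sum>l<n. A $$ (k, l) * x k * x l) > 0" by blast
    show "num_nonpos_eigs A \<le> m"
    proof (rule ccontr)
      assume "\<not> ?thesis"
      then have "card {..<m} < card ?N" by (simp add: num)
      from homogeneous_system_nontrivial[OF _ _ this, of "\<lambda>k i. \<Sum>l<n. f k l * u i l"]
      obtain c where c: "\<exists>i\<in>?N. c i \<noteq> 0" "\<And>k. k < m \<Longrightarrow> (\<Sum>i\<in>?N. (\<Sum>l<n. f k l * u i l) * c i) = 0"
        by auto
      define x where "x k = (\<Sum>i\<in>?N. c i * u i k)" for k
      have y: "y x i = (if i \<in> ?N then c i else 0)" if "i < n" for i
      proof -
        have "y x i = (\<Sum>k<n. \<Sum>j\<in>?N. c j * (u i k * u j k))"
          by (simp add: y_def x_def sum_distrib_left mult_ac)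
        also have "\<dots> = (\<Sum>j\<in>?N. c j * (\<Sum>k<n. u i k * u j k))"
          by (subst sum.swap) (simp add: sum_distrib_left)
        also have "\<dots> = (\<Sum>j\<in>?N. if j = i then c i else 0)"
          using that by (intro sum.cong refl) (auto simp: u1)
        finally show ?thesis by simp
      qed
      have "\<exists>i<n. x i \<noteq> 0"
      proof (rule ccontr)
        assume "\<not> ?thesis"
        then have "y x i = 0" for i by (auto simp: y_def intro!: sum.neutral)
        moreover obtain i where "i \<in> ?N" "c i \<noteq> 0" using c(1) by blast
        ultimately show False using y[of i] by simp
      qed
      moreover have "\<forall>k<m. (\<Sum>i<n. f k i * x i) = 0"
      proof (intro allI impI)
        fix k assume "k < m"
        have "(\<Sum>i<n. f k i * x i) = (\<Sum>l<n. \<Sum>i\<in>?N. f k l * u i l * c i)"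
          by (simp add: x_def sum_distrib_left mult_ac)
        also have "\<dots> = (\<Sum>i\<in>?N. (\<Sum>l<n. f k l * u i l) * c i)"
          by (subst sum.swap) (simp add: sum_distrib_right)
        finally show "(\<Sum>i<n. f k i * x i) = 0" using c(2)[OF \<open>k < m\<close>] by simp
      qed
      ultimately have "(\<Sum>i<n. d i * (y x i)\<^sup>2) > 0" using f[of x] unfolding form by blast
      moreover have "(\<Sum>i<n. d i * (y x i)\<^sup>2) \<le> 0"
        by (intro sum_nonpos) (auto simp: y mult_nonpos_nonneg)
      ultimately show False by simp
    qed
  qed
qed

subsection \<open>The adjacency form\<close>

definition adj_form :: "nat \<Rightarrow> (nat \<Rightarrow> nat \<Rightarrow> bool) \<Rightarrow> (nat \<Rightarrow> real) \<Rightarrow> (nat \<Rightarrow> real) \<Rightarrow> real" where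
  "adj_form n E x y = (\<Sum>i<n. \<Sum>j<n. of_bool (E i j) * x i * y j)"

lemma adj_form_add:
  "adj_form n E (\<lambda>i. x i + y i) z = adj_form n E x z + adj_form n E y z"
  "adj_form n E z (\<lambda>i. x i + y i) = adj_form n E z x + adj_form n E z y"
  by (simp_all add: adj_form_def sum.distrib algebra_simps)

lemma adj_form_diff:
  "adj_form n E (\<lambda>i. x i - y i) z = adj_form n E x z - adj_form n E y z"
  "adj_form n E z (\<lambda>i. x i - y i) = adj_form n E z x - adj_form n E z y"
  by (simp_all add: adj_form_def sum_subtractf algebra_simps)

lemma adj_form_scale:
  "adj_form n E (\<lambda>i. c * x i) z = c * adj_form n E x z"
  "adj_form n E z (\<lambda>i. c * x i) = c * adj_form n E z x"
  by (simp_all add: adj_form_def sum_distrib_left mult_ac)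

lemma adj_form_zero: "adj_form n E (\<lambda>i. 0) z = 0" "adj_form n E z (\<lambda>i. 0) = 0"
  by (simp_all add: adj_form_def)

lemma adj_form_sum:
  "adj_form n E (\<lambda>i. \<Sum>j\<in>J. w j i) z = (\<Sum>j\<in>J. adj_form n E (w j) z)"
  "adj_form n E z (\<lambda>i. \<Sum>j\<in>J. w j i) = (\<Sum>j\<in>J. adj_form n E z (w j))"
  by (induction J rule: infinite_finite_induct; simp add: adj_form_zero adj_form_add)+

definition unit_fun :: "nat \<Rightarrow> nat \<Rightarrow> real" where "unit_fun k = (\<lambda>i. of_bool (i = k))"

lemma unit_fun_simps [simp]: "unit_fun k k = 1" "i \<noteq> k \<Longrightarrow> unit_fun k i = 0"
  by (auto simp: unit_fun_def)

text \<open>\<open>positive\<close> is the kernel criterion for at most four nonpositive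
  eigenvalues. Edges exist only below \<open>n\<close>, so symmetry can be stated without bounds and
  the index \<open>n\<close> can stand for an extra isolated vertex.\<close>

locale few_nonpos_graph =
  fixes n :: nat and E :: "nat \<Rightarrow> nat \<Rightarrow> bool" and f :: "nat \<Rightarrow> nat \<Rightarrow> real"
  assumes sym: "E i j \<longleftrightarrow> E j i" and irrefl [simp]: "\<not> E i i"
    and support: "E i j \<Longrightarrow> i < n"
    and positive: "\<exists>i<n. x i \<noteq> 0 \<Longrightarrow> \<forall>k<4. (\<Sum>i<n. f k i * x i) = 0 \<Longrightarrow> 0 < adj_form n E x x"
begin

lemma form_commute: "adj_form n E x y = adj_form n E y x"
proof -
  have "adj_form n E x y = (\<Sum>j<n. \<Sum>i<n. of_bool (E i j) * x i * y j)"
    unfolding adj_form_def by (rule sum.swap)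
  then show ?thesis unfolding adj_form_def by (simp add: sym mult_ac)
qed

lemma form_unit_left: "adj_form n E (unit_fun k) y = (\<Sum>j<n. of_bool (E k j) * y j)"
proof -
  have "adj_form n E (unit_fun k) y = (\<Sum>i<n. if i = k then \<Sum>j<n. of_bool (E k j) * y j else 0)"
    unfolding adj_form_def by (intro sum.cong) (auto simp: unit_fun_def)
  also have "\<dots> = (if k < n then \<Sum>j<n. of_bool (E k j) * y j else 0)" by simp
  also have "\<dots> = (\<Sum>j<n. of_bool (E k j) * y j)"
  proof (cases "k < n")
    case False
    then have "\<not> E k j" for j using support by blast
    with False show ?thesis by simp
  qed simp
  finally show ?thesis .
qed

lemma form_unit [simp]: "adj_form n E (unit_fun k) (unit_fun l) = of_bool (E k l)"
proof -
  have "adj_form n E (unit_fun k) (unit_fun l) = (\<Sum>j<n. if j = l then of_bool (E k l) else 0)"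
    unfolding form_unit_left by (intro sum.cong) (auto simp: unit_fun_def)
  also have "\<dots> = of_bool (E k l)" using support[of l k] sym[of k l] by auto
  finally show ?thesis .
qed

text \<open>Four functionals on a five-dimensional space of coefficients have a common zero. The
  first alternative covers linearly dependent vectors.\<close>

lemma five_vectors:
  fixes w :: "nat \<Rightarrow> nat \<Rightarrow> real"
  shows "\<exists>c. (\<exists>j<5. c j \<noteq> 0) \<and> ((\<forall>i<n. (\<Sum>j<5. c j * w j i) = 0) \<or>
    0 < (\<Sum>j<5. \<Sum>k<5. c j * c k * adj_form n E (w j) (w k)))"
proof -
  obtain c where c: "\<exists>j<5. c j \<noteq> 0" "\<And>k. k < 4 \<Longrightarrow> (\<Sum>j<5. (\<Sum>i<n. f k i * w j i) * c j) = 0"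
    using homogeneous_system_nontrivial[of "{..<4::nat}" "{..<5::nat}" "\<lambda>k j. \<Sum>i<n. f k i * w j i"]
    by auto
  define v where "v = (\<lambda>i. \<Sum>j<5. c j * w j i)"
  have "(\<Sum>i<n. f k i * v i) = 0" if "k < 4" for k
  proof -
    have "(\<Sum>i<n. f k i * v i) = (\<Sum>i<n. \<Sum>j<5. f k i * w j i * c j)"
      by (simp add: v_def sum_distrib_left mult_ac)
    also have "\<dots> = (\<Sum>j<5. (\<Sum>i<n. f k i * w j i) * c j)"
      by (subst sum.swap) (simp only: sum_distrib_right)
    finally show ?thesis using c(2)[OF that] by simp
  qed
  then have "(\<forall>i<n. v i = 0) \<or> 0 < adj_form n E v v" using positive[of v] by blast
  moreover have "adj_form n E v v = (\<Sum>j<5. \<Sum>k<5. c j * c k * adj_form n E (w j) (w k))"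
    unfolding v_def adj_form_sum adj_form_scale by (simp only: mult.assoc mult.left_commute)
  ultimately show ?thesis using c(1) by (intro exI[of _ c]) (simp only: v_def simp_thms)
qed

text \<open>Otherwise \<open>d\<close> together with the four vectors \<open>u j\<close> would span
  a nonpositive space of dimension five: by orthogonality the form splits into the part on the
  \<open>u j\<close> and the part on \<open>d\<close>.\<close>

lemma positive_orthogonal:
  fixes u :: "nat \<Rightarrow> nat \<Rightarrow> real"
  assumes "\<And>c. (\<Sum>j<4. \<Sum>k<4. c j * c k * adj_form n E (u j) (u k)) \<le> 0"
    and orth: "\<And>j. j < 4 \<Longrightarrow> adj_form n E (u j) d = 0"
    and indep: "\<And>c t. \<forall>i<n. (\<Sum>j<4. c j * u j i) + t * d i = 0 \<Longrightarrow> t = 0 \<and> (\<forall>j<4. c j = 0)"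
  shows "0 < adj_form n E d d"
proof -
  define w where "w j = (if j < 4 then u j else d)" for j :: nat
  have five: "(\<Sum>j<5. g j) = (\<Sum>j<4. g j) + g 4" for g :: "nat \<Rightarrow> real"
    using sum.lessThan_Suc[of g 4] by simp
  have w: "w 4 = d" "\<And>j. j \<in> {..<4} \<Longrightarrow> w j = u j" by (auto simp: w_def)
  obtain c where c: "\<exists>j<5. c j \<noteq> 0" "(\<forall>i<n. (\<Sum>j<5. c j * w j i) = 0) \<or>
      0 < (\<Sum>j<5. \<Sum>k<5. c j * c k * adj_form n E (w j) (w k))"
    using five_vectors[of w] by blast
  have nonzero: "\<not> (\<forall>i<n. (\<Sum>j<5. c j * w j i) = 0)"
  proof
    assume "\<forall>i<n. (\<Sum>j<5. c j * w j i) = 0"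
    then have "\<forall>i<n. (\<Sum>j<4. c j * u j i) + c 4 * d i = 0" by (simp add: five w)
    from indep[of c "c 4", OF this] have zero: "c 4 = 0" "\<And>j. j < 4 \<Longrightarrow> c j = 0" by blast+
    obtain j where j: "j < 5" "c j \<noteq> 0" using c(1) by blast
    show False
    proof (cases "j = 4")
      case False
      then have "j < 4" using j(1) by simp
      then show False using zero(2) j(2) by simp
    qed (use j(2) zero(1) in simp)
  qed
  have "0 < (\<Sum>j<5. \<Sum>k<5. c j * c k * adj_form n E (w j) (w k))"
    by (rule mp[OF c(2)[unfolded disj_imp] nonzero])
  also have "\<dots> = (\<Sum>j<4. \<Sum>k<4. c j * c k * adj_form n E (u j) (u k)) + (c 4)\<^sup>2 * adj_form n E d d"
  proof -
    have orth': "\<And>j. j < 4 \<Longrightarrow> adj_form n E d (u j) = 0" using orth form_commute by metis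
    show ?thesis using orth orth' by (simp add: five w sum.distrib power2_eq_square)
  qed
  also have "\<dots> \<le> (c 4)\<^sup>2 * adj_form n E d d" using assms(1)[of c] by simp
  finally show ?thesis by (simp add: zero_less_mult_iff)
qed

text \<open>The form vanishes on vectors supported on an independent set, so four independent
  vertices use up all nonpositive directions.\<close>

lemma positive_on_kernel_of_independent4:
  fixes a :: "nat \<Rightarrow> nat"
  assumes inj: "inj_on a {..<4}" and indep: "\<And>j k. j < 4 \<Longrightarrow> k < 4 \<Longrightarrow> \<not> E (a j) (a k)"
    and vert: "\<And>j. j < 4 \<Longrightarrow> a j < n"
    and off: "\<And>j. j < 4 \<Longrightarrow> d (a j) = 0" and i: "i < n" "d i \<noteq> 0"
    and ker: "\<And>j. j < 4 \<Longrightarrow> adj_form n E (unit_fun (a j)) d = 0"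
  shows "0 < adj_form n E d d"
proof (rule positive_orthogonal[of "\<lambda>j. unit_fun (a j)"])
  fix c :: "nat \<Rightarrow> real" and t
  assume *: "\<forall>i<n. (\<Sum>j<4. c j * unit_fun (a j) i) + t * d i = 0"
  have zero: "c k = 0" if "k < 4" for k
  proof -
    have "(\<Sum>j<4. c j * unit_fun (a j) (a k)) = (\<Sum>j<4. if j = k then c k else 0)"
      using that inj by (intro sum.cong) (auto simp: unit_fun_def inj_on_def)
    then show ?thesis using *[rule_format, OF vert[OF that]] off[OF that] that by simp
  qed
  have "t * d i = 0" using *[rule_format, OF i(1)] zero by simp
  with zero i(2) show "t = 0 \<and> (\<forall>j<4. c j = 0)" by simp
qed (use indep ker in auto)

text \<open>The fifth vertex would be orthogonal to the other four, yet its form value is 0 because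
  there are no loops.\<close>

lemma no_independent5:
  fixes a :: "nat \<Rightarrow> nat"
  assumes inj: "inj_on a {..<5}" and indep: "\<And>j k. j < 5 \<Longrightarrow> k < 5 \<Longrightarrow> \<not> E (a j) (a k)"
    and vert: "\<And>j. j < 5 \<Longrightarrow> a j < n"
  shows False
proof -
  have "0 < adj_form n E (unit_fun (a 4)) (unit_fun (a 4))"
  proof (rule positive_on_kernel_of_independent4[of a _ "a 4"])
    show "inj_on a {..<4}" using inj by (rule inj_on_subset) auto
    show "unit_fun (a 4) (a j) = 0" if "j < 4" for j
      using that inj_onD[OF inj, of j 4] by (auto simp: unit_fun_def)
  qed (use indep vert in auto)
  then show False by simp
qed

text \<open>Three independent vertices use up three of the four possible nonpositive directions, so
  a plane orthogonal to them cannot be nonpositive.\<close>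

lemma indefinite_on_kernel_of_independent3:
  fixes a :: "nat \<Rightarrow> nat"
  assumes inj: "inj_on a {..<3}" and indep: "\<And>j k. j < 3 \<Longrightarrow> k < 3 \<Longrightarrow> \<not> E (a j) (a k)"
    and vert: "\<And>j. j < 3 \<Longrightarrow> a j < n"
    and off: "\<And>j. j < 3 \<Longrightarrow> d1 (a j) = 0" "\<And>j. j < 3 \<Longrightarrow> d2 (a j) = 0"
    and lin: "\<And>s t. \<forall>i<n. s * d1 i + t * d2 i = 0 \<Longrightarrow> s = 0 \<and> t = 0"
    and ker: "\<And>j. j < 3 \<Longrightarrow> adj_form n E (unit_fun (a j)) d1 = 0"
             "\<And>j. j < 3 \<Longrightarrow> adj_form n E (unit_fun (a j)) d2 = 0"
  shows "\<exists>s t. 0 < s\<^sup>2 * adj_form n E d1 d1 + 2 * s * t * adj_form n E d1 d2 + t\<^sup>2 * adj_form n E d2 d2"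
proof -
  define w where "w j = (if j < 3 then unit_fun (a j) else if j = 3 then d1 else d2)" for j :: nat
  have five: "(\<Sum>j<5. g j) = (\<Sum>j<3. g j) + g 3 + g 4" for g :: "nat \<Rightarrow> real"
    using sum.lessThan_Suc[of g 4] sum.lessThan_Suc[of g 3] by simp
  have w: "w 3 = d1" "w 4 = d2" "\<And>j. j \<in> {..<3} \<Longrightarrow> w j = unit_fun (a j)" by (auto simp: w_def)
  obtain c where c: "\<exists>j<5. c j \<noteq> 0" "(\<forall>i<n. (\<Sum>j<5. c j * w j i) = 0) \<or>
      0 < (\<Sum>j<5. \<Sum>k<5. c j * c k * adj_form n E (w j) (w k))"
    using five_vectors[of w] by blast
  have nonzero: "\<not> (\<forall>i<n. (\<Sum>j<5. c j * w j i) = 0)"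
  proof
    assume "\<forall>i<n. (\<Sum>j<5. c j * w j i) = 0"
    then have *: "\<forall>i<n. (\<Sum>j<3. c j * unit_fun (a j) i) + c 3 * d1 i + c 4 * d2 i = 0" by (simp add: five w)
    have c3: "c k = 0" if "k < 3" for k
    proof -
      have "(\<Sum>j<3. c j * unit_fun (a j) (a k)) = (\<Sum>j<3. if j = k then c k else 0)"
        using that inj by (intro sum.cong) (auto simp: unit_fun_def inj_on_def)
      then show ?thesis using *[rule_format, OF vert[OF that]] off(1)[OF that] off(2)[OF that] that by simp
    qed
    with * have "\<forall>i<n. c 3 * d1 i + c 4 * d2 i = 0" by simp
    from lin[of "c 3" "c 4", OF this] have zero: "c 3 = 0" "c 4 = 0" by blast+
    obtain j where j: "j < 5" "c j \<noteq> 0" using c(1) by blast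
    then have "j < 3 \<or> j = 3 \<or> j = 4" by auto
    then show False using c3[of j] j(2) zero by (elim disjE) simp_all
  qed
  have "0 < (\<Sum>j<5. \<Sum>k<5. c j * c k * adj_form n E (w j) (w k))"
    by (rule mp[OF c(2)[unfolded disj_imp] nonzero])
  also have "\<dots> = (c 3)\<^sup>2 * adj_form n E d1 d1 + 2 * c 3 * c 4 * adj_form n E d1 d2 + (c 4)\<^sup>2 * adj_form n E d2 d2"
  proof -
    have ker': "\<And>j. j < 3 \<Longrightarrow> adj_form n E d1 (unit_fun (a j)) = 0"
      "\<And>j. j < 3 \<Longrightarrow> adj_form n E d2 (unit_fun (a j)) = 0" using ker form_commute by metis+
    show ?thesis using ker ker' indep
      by (simp add: five w sum.distrib form_commute[of d2 d1] power2_eq_square algebra_simps)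
  qed
  finally show ?thesis by blast
qed

end

subsection \<open>Independence number at most two\<close>

definition clique :: "('a \<Rightarrow> 'a \<Rightarrow> bool) \<Rightarrow> 'a set \<Rightarrow> bool" where
  "clique E K \<longleftrightarrow> (\<forall>x\<in>K. \<forall>y\<in>K. x \<noteq> y \<longrightarrow> E x y)"

definition independent :: "('a \<Rightarrow> 'a \<Rightarrow> bool) \<Rightarrow> 'a set \<Rightarrow> bool" where
  "independent E I \<longleftrightarrow> (\<forall>x\<in>I. \<forall>y\<in>I. x \<noteq> y \<longrightarrow> \<not> E x y)"

text \<open>The Ramsey bound \<open>R(3, k) \<le> k * (k + 1) / 2\<close>. The non-neighbours of a
  vertex \<open>v\<close> form a clique; if it is too small, the neighbours of \<open>v\<close> are
  numerous enough for induction, and \<open>v\<close> extends the clique found among them.\<close>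

lemma clique_if_no_independent3:
  assumes sym: "\<And>x y. E x y \<longleftrightarrow> E y x" and "finite W" "k * (k + 1) \<le> 2 * card W"
    and "\<And>I. I \<subseteq> W \<Longrightarrow> independent E I \<Longrightarrow> card I \<le> 2"
  shows "\<exists>K\<subseteq>W. card K = k \<and> clique E K"
  using assms(2-)
proof (induction k arbitrary: W)
  case 0
  then show ?case by (intro exI[of _ "{}"]) (simp add: clique_def)
next
  case (Suc k)
  note fin = Suc.prems(1) and large = Suc.prems(2) and small = Suc.prems(3)
  have "card W > 0" using large by (cases "card W") auto
  then obtain v where v: "v \<in> W" by fastforce
  define A where "A = {x \<in> W. x \<noteq> v \<and> E v x}"
  define B where "B = {x \<in> W. x \<noteq> v \<and> \<not> E v x}"
  have AB: "finite A" "finite B" "A \<inter> B = {}" "v \<notin> A \<union> B" "W = insert v (A \<union> B)"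
    using fin v by (auto simp: A_def B_def)
  have card: "card W = Suc (card A + card B)"
  proof -
    have "card W = Suc (card (A \<union> B))"
      using AB(1,2,4) by (subst AB(5)) (rule card_insert_disjoint, simp_all)
    then show ?thesis using card_Un_disjoint[OF AB(1-3)] by simp
  qed
  have B: "clique E B"
    unfolding clique_def
  proof (intro ballI impI)
    fix x y assume xy: "x \<in> B" "y \<in> B" "x \<noteq> y"
    show "E x y"
    proof (rule ccontr)
      assume "\<not> E x y"
      moreover have "\<not> E v x" "\<not> E v y" using xy by (auto simp: B_def)
      ultimately have "\<not> E x y" "\<not> E v x" "\<not> E v y" "\<not> E y x" "\<not> E x v" "\<not> E y v"
        using sym by blast+
      then have "independent E {v, x, y}" by (auto simp: independent_def)
      from small[OF _ this] have "card {v, x, y} \<le> 2" using xy v by (auto simp: B_def)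
      moreover have "card {v, x, y} = 3" using xy by (auto simp: B_def)
      ultimately show False by simp
    qed
  qed
  show ?case
  proof (cases "Suc k \<le> card B")
    case True
    then obtain K where "K \<subseteq> B" "card K = Suc k" using obtain_subset_with_card_n by metis
    then show ?thesis using B AB(5) by (intro exI[of _ K]) (auto simp: clique_def)
  next
    case False
    \<comment> \<open>Deleting \<open>v\<close> and at most \<open>k\<close> non-neighbours from
      \<open>(k + 1) * (k + 2) / 2\<close> vertices leaves \<open>k * (k + 1) / 2\<close>.\<close>
    then have "k * (k + 1) \<le> 2 * card A" using large card by (simp add: algebra_simps)
    moreover have "card I \<le> 2" if "I \<subseteq> A" "independent E I" for I
      using small that AB(5) by blast
    ultimately obtain K where K: "K \<subseteq> A" "card K = k" "clique E K" using Suc.IH[OF AB(1)] by metis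
    have "card (insert v K) = Suc k" using K AB by (subst card_insert_disjoint) (auto dest: finite_subset)
    moreover have "E v x" "E x v" if "x \<in> K" for x
      using K(1) that sym[of x v] by (auto simp: A_def)
    then have "clique E (insert v K)" using K(3) by (auto simp: clique_def)
    ultimately show ?thesis using K(1) AB(5) by (intro exI[of _ "insert v K"]) auto
  qed
qed

context few_nonpos_graph
begin

text \<open>The sum-zero vectors on a 5-clique form a four-dimensional negative definite space, so the
  form is positive definite on its orthogonal complement. For a vertex \<open>x\<close> off the clique,
  the vector \<open>y x\<close> below is the component of \<open>x\<close> orthogonal to all vectors on the clique;
  \<open>s\<close> is four times the Gram matrix of these components.\<close>

lemma gram_off_clique5_positive:
  fixes t :: "nat \<Rightarrow> int"
  assumes K: "K \<subseteq> {..<n}" "card K = 5" "clique E K"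
    and T: "finite T" "T \<subseteq> {..<n} - K" "x0 \<in> T" "t x0 \<noteq> 0"
  defines "N \<equiv> \<lambda>x. {l \<in> K. E l x}"
  defines "s \<equiv> \<lambda>x x'. 4 * (of_bool (E x x') + int (card (N x \<inter> N x'))) - int (card (N x)) * int (card (N x'))"
  shows "0 < (\<Sum>x\<in>T. \<Sum>x'\<in>T. t x * t x' * s x x')"
proof -
  have finK: "finite K" using K(2) by (metis card.infinite zero_neq_numeral)
  then obtain k where k: "bij_betw k {..<5::nat} K"
    using K(2) ex_bij_betw_nat_finite[of K] by (auto simp: lessThan_atLeast0)
  have k_mem: "j < 5 \<Longrightarrow> k j \<in> K" and k_eq: "j < 5 \<Longrightarrow> j' < 5 \<Longrightarrow> k j = k j' \<longleftrightarrow> j = j'" for j j'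
    using k by (auto simp: bij_betw_def inj_on_eq_iff)
  \<comment> \<open>On the clique the adjacency matrix is \<open>J - 1\<close>, where
    \<open>J\<close> is all-ones, with inverse \<open>J / 4 - 1\<close>; solving the orthogonality
    equations with it gives these coefficients.\<close>
  define c where "c x l = of_bool (E l x) - real (card (N x)) / 4" for x l
  define y where "y x = (\<lambda>i. unit_fun x i + (\<Sum>l\<in>K. c x l * unit_fun l i))" for x
  have sum_c: "(\<Sum>l\<in>K. c x l) = - real (card (N x)) / 4" for x
    using K(2) finK by (simp add: c_def sum_subtractf N_def Int_def)
  have orth: "adj_form n E (unit_fun l) (y x) = 0" if "l \<in> K" for l x
  proof -
    have "adj_form n E (unit_fun l) (y x) = of_bool (E l x) + (\<Sum>l'\<in>K. c x l' * of_bool (E l l'))"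
      by (simp add: y_def adj_form_add adj_form_sum adj_form_scale)
    also have "(\<Sum>l'\<in>K. c x l' * of_bool (E l l')) = (\<Sum>l'\<in>K. c x l' - (if l' = l then c x l else 0))"
      using K(3) that by (intro sum.cong) (auto simp: clique_def)
    also have "\<dots> = (\<Sum>l'\<in>K. c x l') - c x l" using finK that by (simp add: sum_subtractf)
    finally show ?thesis by (simp add: sum_c) (simp add: c_def)
  qed
  have gram: "adj_form n E (y x) (y x') = s x x' / 4" for x x'
  proof -
    have "adj_form n E (y x) (y x') = adj_form n E (unit_fun x) (y x') + (\<Sum>l\<in>K. c x l * adj_form n E (unit_fun l) (y x'))"
      by (subst (1) y_def) (simp add: adj_form_add(1) adj_form_sum(1) adj_form_scale(1))
    also have "(\<Sum>l\<in>K. c x l * adj_form n E (unit_fun l) (y x')) = 0" by (simp add: orth)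
    also have "adj_form n E (unit_fun x) (y x') = of_bool (E x x') + (\<Sum>l\<in>K. c x' l * of_bool (E x l))"
      by (simp add: y_def adj_form_add adj_form_sum adj_form_scale)
    also have "(\<Sum>l\<in>K. c x' l * of_bool (E x l)) =
      (\<Sum>l\<in>K. of_bool (E l x \<and> E l x')) - card (N x') / 4 * (\<Sum>l\<in>K. of_bool (E l x))"
      unfolding sum_distrib_left sum_subtractf[symmetric]
      by (intro sum.cong) (auto simp: c_def sym[of x] algebra_simps)
    also have "(\<Sum>l\<in>K. of_bool (E l x \<and> E l x')) = real (card (N x \<inter> N x'))"
      using finK by (auto simp: N_def intro!: arg_cong[of _ _ card])
    also have "(\<Sum>l\<in>K. of_bool (E l x)) = real (card (N x))"
      using finK by (auto simp: N_def intro!: arg_cong[of _ _ card])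
    finally show ?thesis by (simp add: s_def field_simps)
  qed
  define d where "d = (\<lambda>i. \<Sum>x\<in>T. t x * y x i)"
  \<comment> \<open>A basis of the sum-zero vectors on the clique. Its Gram matrix is
    \<open>- J - 1\<close>, hence negative definite.\<close>
  define u where "u j = (\<lambda>i. unit_fun (k (Suc j)) i - unit_fun (k 0) i)" for j
  have "0 < adj_form n E d d"
  proof (rule positive_orthogonal[of u])
    fix c :: "nat \<Rightarrow> real"
    have uu: "adj_form n E (u i) (u j) = - 1 - of_bool (i = j)" if "i < 4" "j < 4" for i j
      using K(3) k_mem k_eq[of "Suc i" "Suc j"] k_eq[of "Suc i" 0] k_eq[of 0 "Suc j"] that
      by (auto simp: u_def adj_form_diff clique_def)
    have "(\<Sum>i<4. \<Sum>j<4. c i * c j * adj_form n E (u i) (u j)) =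
      (\<Sum>i<4. \<Sum>j<4. - (c i * c j) - (if j = i then c i * c i else 0))"
      by (intro sum.cong refl) (auto simp: uu)
    also have "\<dots> = - (\<Sum>i<4. c i)\<^sup>2 - (\<Sum>i<4. (c i)\<^sup>2)"
      by (simp add: sum_subtractf sum_negf power2_eq_square sum_product)
    also have "\<dots> \<le> 0"
      using zero_le_power2[of "\<Sum>i<4. c i"] sum_nonneg[of "{..<4}" "\<lambda>i. (c i)\<^sup>2", OF zero_le_power2]
      by linarith
    finally show "(\<Sum>i<4. \<Sum>j<4. c i * c j * adj_form n E (u i) (u j)) \<le> 0" .
  next
    fix j :: nat assume "j < 4"
    then show "adj_form n E (u j) d = 0"
      by (simp add: u_def d_def adj_form_diff adj_form_sum adj_form_scale orth k_mem)
  next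
    fix c :: "nat \<Rightarrow> real" and r
    assume *: "\<forall>i<n. (\<Sum>j<4. c j * u j i) + r * d i = 0"
    have x0: "x0 < n" "x0 \<notin> K" using T by auto
    \<comment> \<open>Off the clique \<open>y x\<close> is the unit vector of \<open>x\<close>, so
      the entry of \<open>d\<close> at \<open>x0\<close> is \<open>t x0\<close>, which is
      nonzero.\<close>
    have "y x x0 = (if x = x0 then 1 else 0)" for x
      using x0 by (auto simp: y_def unit_fun_def intro!: sum.neutral)
    then have "d x0 = (\<Sum>x\<in>T. if x = x0 then real_of_int (t x0) else 0)"
      unfolding d_def by (intro sum.cong) auto
    then have "d x0 = t x0" using T by simp
    moreover have "u j x0 = 0" if "j < 4" for j
      using x0 k_mem[of 0] k_mem[of "Suc j"] that by (auto simp: u_def unit_fun_def)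
    ultimately have r: "r = 0" using *[rule_format, OF x0(1)] T(4) by simp
    have "c i = 0" if "i < 4" for i
    proof -
      have "k (Suc i) < n" using k_mem[of "Suc i"] K(1) that by auto
      from *[rule_format, OF this] have "(\<Sum>j<4. c j * u j (k (Suc i))) = 0" by (simp add: r)
      moreover have "(\<Sum>j<4. c j * u j (k (Suc i))) = (\<Sum>j<4. if j = i then c i else 0)"
        using that k_eq[of "Suc i"] by (intro sum.cong) (auto simp: u_def unit_fun_def)
      ultimately show ?thesis using that by simp
    qed
    with r show "r = 0 \<and> (\<forall>j<4. c j = 0)" by simp
  qed
  also have "adj_form n E d d = (\<Sum>x\<in>T. \<Sum>x'\<in>T. t x * t x' * s x x') / 4"
    unfolding d_def adj_form_sum adj_form_scale gram sum_divide_distrib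
    by (simp add: sum_distrib_left sum_divide_distrib mult_ac)
  finally have "0 < real_of_int (\<Sum>x\<in>T. \<Sum>x'\<in>T. t x * t x' * s x x')" by simp
  then show ?thesis by (simp only: of_int_0_less_iff)
qed

text \<open>Positivity of \<open>s x x = m x * (4 - m x)\<close> leaves 1, 2 or 3 neighbours in the
  clique. Vertices with two neighbours (\<open>T2\<close>) are mutually orthogonal and have distinct
  neighbour pairs, so there are at most ten. At most three vertices are of the other kinds
  (\<open>T1\<close>), and as soon as one exists, \<open>T2\<close> has at most two
  elements.\<close>

lemma card_off_clique5_le:
  assumes K: "K \<subseteq> {..<n}" "card K = 5" "clique E K" and T: "finite T" "T \<subseteq> {..<n} - K"
  shows "card T \<le> 10"
proof -
  define N where "N x = {l \<in> K. E l x}" for x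
  define m where "m x = int (card (N x))" for x
  define s where "s x x' = 4 * (of_bool (E x x') + int (card (N x \<inter> N x'))) - m x * m x'" for x x'
  have finK: "finite K" using K(2) by (metis card.infinite zero_neq_numeral)
  have s_comm: "s x x' = s x' x" for x x' by (simp add: s_def Int_commute mult.commute sym[of x])
  have pos: "0 < (\<Sum>x\<in>S. \<Sum>x'\<in>S. t x * t x' * s x x')"
    if "S \<subseteq> T" "x0 \<in> S" "t x0 \<noteq> 0" for S x0 and t :: "nat \<Rightarrow> int"
    using gram_off_clique5_positive[OF K, of S x0 t] that T
    by (auto simp: s_def m_def N_def dest: finite_subset)
  have s_diag: "s x x = 4 * m x - m x * m x" for x by (simp add: s_def m_def)
  have m_cases: "m x = 1 \<or> m x = 2 \<or> m x = 3" if "x \<in> T" for x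
  proof -
    have "0 < s x x" using pos[of "{x}" x "\<lambda>_. 1"] that by simp
    then have "0 < m x * (4 - m x)" by (simp add: s_diag algebra_simps)
    moreover have "0 \<le> m x" by (simp add: m_def)
    ultimately show ?thesis by (auto simp: zero_less_mult_iff)
  qed
  \<comment> \<open>Strict Cauchy-Schwarz, tested on the part of \<open>x'\<close> orthogonal to
    \<open>x\<close>, scaled by \<open>s x x\<close>.\<close>
  have pair: "(s x x')\<^sup>2 < s x x * s x' x'" if "x \<in> T" "x' \<in> T" "x \<noteq> x'" for x x'
  proof -
    have "s x x > 0" using pos[of "{x}" x "\<lambda>_. 1"] that by simp
    moreover have "0 < s x x * (s x x * s x' x' - (s x x')\<^sup>2)"
      using pos[of "{x, x'}" x' "\<lambda>z. if z = x then - s x x' else s x x"] that \<open>s x x > 0\<close>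
      by (simp add: s_comm[of x' x] algebra_simps power2_eq_square)
    ultimately show ?thesis by (simp add: zero_less_mult_iff)
  qed
  define T2 where "T2 = {x \<in> T. m x = 2}"
  define T1 where "T1 = {x \<in> T. m x \<noteq> 2}"
  have fin: "finite T1" "finite T2" using T by (auto simp: T1_def T2_def)
  have "card T = card T1 + card T2"
    using fin by (subst card_Un_disjoint[symmetric]) (auto simp: T1_def T2_def intro!: arg_cong[of _ _ card])
  have s22: "s x x' = 0" if x: "x \<in> T2" "x' \<in> T2" "x \<noteq> x'" for x x'
  proof -
    define q where "q = of_bool (E x x') + int (card (N x \<inter> N x')) - 1"
    \<comment> \<open>The entry is a multiple of 4 whose square is below 16.\<close>
    have q: "s x x' = 4 * q" using x by (simp add: s_def T2_def q_def)
    have "(s x x')\<^sup>2 < 16" using pair[of x x'] x by (simp add: T2_def s_diag)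
    then have "q\<^sup>2 < 1" unfolding q by (simp add: power_mult_distrib)
    then have "q = 0" by (metis power2_less_eq_zero_iff zle_diff1_eq diff_self)
    then show ?thesis by (simp add: q)
  qed
  have "inj_on N T2"
  proof (rule inj_onI, rule ccontr)
    fix x x' assume *: "x \<in> T2" "x' \<in> T2" "N x = N x'" "x \<noteq> x'"
    then have "s x x' = 4 * of_bool (E x x') + 4" by (simp add: s_def T2_def m_def)
    then show False using s22[OF *(1,2,4)] by (simp add: of_bool_def split: if_splits)
  qed
  moreover have "N ` T2 \<subseteq> {S. S \<subseteq> K \<and> card S = 2}" by (auto simp: T2_def m_def N_def)
  ultimately have "card T2 \<le> card {S. S \<subseteq> K \<and> card S = 2}" using finK by (intro card_inj_on_le) auto
  also have "\<dots> = 10" using n_subsets[OF finK, of 2] K(2) by (simp add: choose_two)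
  finally have T2_le: "card T2 \<le> 10" .
  \<comment> \<open>Signs that turn every off-diagonal Gram entry on \<open>T1\<close> into
    -1.\<close>
  define e where "e x = (if m x = 1 then 1 else - 1 :: int)" for x
  have s11: "s x x' = (if x = x' then 3 else - e x * e x')" if x: "x \<in> T1" "x' \<in> T1" for x x'
  proof (cases "x = x'")
    case True
    then show ?thesis using x m_cases[of x] by (auto simp: T1_def s_diag)
  next
    case False
    have m: "m x = 1 \<or> m x = 3" "m x' = 1 \<or> m x' = 3" using x m_cases by (auto simp: T1_def)
    define q where "q = of_bool (E x x') + int (card (N x \<inter> N x'))"
    \<comment> \<open>Modulo 4 the entry is \<open>- m x * m x'\<close> with both factors odd; only
      1 or -1, as the residue dictates, has absolute value below 3.\<close>
    have q: "s x x' = 4 * q - m x * m x'" by (simp add: s_def q_def)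
    have "(s x x')\<^sup>2 < 9" using pair[of x x'] x False m by (auto simp: T1_def s_diag)
    then have "\<bar>s x x'\<bar> < 3" using power2_less_imp_less[of "\<bar>s x x'\<bar>" 3] by simp
    then show ?thesis using q m False by (auto simp: e_def; presburger)
  qed
  have "card T1 \<le> 3"
  proof (rule ccontr)
    assume "\<not> ?thesis"
    then obtain S where S: "S \<subseteq> T1" "card S = 4" using obtain_subset_with_card_n[of 4 T1] by auto
    then have finS: "finite S" using fin by (auto dest: finite_subset)
    have e2: "e x * e x = 1" for x by (simp add: e_def)
    from S obtain x0 where "x0 \<in> S" by fastforce
    have "0 < (\<Sum>x\<in>S. \<Sum>x'\<in>S. e x * e x' * s x x')"
    proof (rule pos[OF _ \<open>x0 \<in> S\<close>])
      show "S \<subseteq> T" using S(1) by (auto simp: T1_def)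
      show "e x0 \<noteq> 0" by (simp add: e_def)
    qed
    \<comment> \<open>The signed Gram matrix is \<open>4 - J\<close>, which annihilates the all-ones
      vector in dimension four.\<close>
    also have "\<dots> = (\<Sum>x\<in>S. \<Sum>x'\<in>S. (if x' = x then 4 else 0) - 1)"
    proof (intro sum.cong refl)
      fix x x' assume "x \<in> S" "x' \<in> S"
      then have "s x x' = (if x = x' then 3 else - e x * e x')" using s11 S by blast
      then show "e x * e x' * s x x' = (if x' = x then 4 else 0) - 1"
        by (simp add: e_def)
    qed
    also have "\<dots> = 0" using S finS by (simp add: sum_subtractf)
    finally show False by simp
  qed
  moreover have "card T2 \<le> 2" if x: "x \<in> T1" for x
  proof (rule ccontr)
    assume "\<not> ?thesis"
    then obtain S where S: "S \<subseteq> T2" "card S = 3" using obtain_subset_with_card_n[of 3 T2] by auto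
    then have finS: "finite S" using fin by (auto dest: finite_subset)
    have xS: "x \<notin> S" using x S by (auto simp: T1_def T2_def)
    have m: "m x = 1 \<or> m x = 3" using x m_cases by (auto simp: T1_def)
    have s12: "s x y * s x y = 4" if y: "y \<in> S" for y
    proof -
      have m2: "m y = 2" "y \<in> T" using y S by (auto simp: T2_def)
      define q where "q = of_bool (E x y) + int (card (N x \<inter> N y))"
      \<comment> \<open>As \<open>m x\<close> is odd, the entry is 2 modulo 4; its square being
        below 12 leaves 2 and -2.\<close>
      have q: "s x y = 4 * q - 2 * m x" by (simp add: s_def q_def m2)
      have "x \<noteq> y" using xS y by blast
      then have "(s x y)\<^sup>2 < 12" using pair[of x y] x m2 m by (auto simp: T1_def s_diag)
      then have "\<bar>s x y\<bar> < 4" using power2_less_imp_less[of "\<bar>s x y\<bar>" 4] by simp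
      then have "s x y = 2 \<or> s x y = - 2" using q m by presburger
      then show ?thesis by auto
    qed
    \<comment> \<open>Four times the component of \<open>x\<close> orthogonal to the three vertices
      of \<open>S\<close>. Its form value is \<open>48 - 96 + 48 = 0\<close>.\<close>
    define t where "t z = (if z = x then 4 else - s x z)" for z
    have "0 < (\<Sum>a\<in>insert x S. \<Sum>b\<in>insert x S. t a * t b * s a b)"
    proof (rule pos[of _ x])
      show "insert x S \<subseteq> T" using x S(1) by (auto simp: T1_def T2_def)
      show "t x \<noteq> 0" by (simp add: t_def)
    qed simp
    also have "\<dots> = 16 * s x x + 2 * (\<Sum>y\<in>S. 4 * t y * s x y) + (\<Sum>a\<in>S. \<Sum>b\<in>S. t a * t b * s a b)"
    proof -
      have tx: "t x = 4" by (simp add: t_def)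
      have "t a * 4 * s a x = 4 * t a * s x a" for a unfolding s_comm[of a x] by simp
      then have "(\<Sum>a\<in>S. t a * 4 * s a x) = (\<Sum>a\<in>S. 4 * t a * s x a)" by (intro sum.cong refl)
      then show ?thesis using finS xS by (simp add: sum.distrib tx)
    qed
    also have "(\<Sum>y\<in>S. 4 * t y * s x y) = (\<Sum>y\<in>S. - 16)"
      using xS s12 by (intro sum.cong) (auto simp: t_def)
    also have "(\<Sum>a\<in>S. \<Sum>b\<in>S. t a * t b * s a b) = (\<Sum>a\<in>S. \<Sum>b\<in>S. if b = a then 16 else 0)"
    proof (intro sum.cong refl)
      fix a b assume ab: "a \<in> S" "b \<in> S"
      then have "a \<in> T2" "b \<in> T2" "a \<noteq> x" using S xS by auto
      then show "t a * t b * s a b = (if b = a then 16 else 0)"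
        using s22[of a b] s12[OF ab(1)] by (auto simp: t_def s_diag T2_def)
    qed
    also have "s x x = 3" using s11[OF x x] by simp
    finally show False using S finS by simp
  qed
  ultimately show ?thesis using \<open>card T = card T1 + card T2\<close> T2_le
    by (cases "T1 = {}") fastforce+
qed

end

subsection \<open>Independence number three\<close>

context few_nonpos_graph
begin

text \<open>In the difference of two twins the edges to \<open>I\<close> cancel, so
  \<open>d1\<close> and \<open>d2\<close> span a plane orthogonal to \<open>I\<close>, on which some
  value must be positive. The form in the conclusion is half the adjacency form on that
  plane.\<close>

lemma twin_differences_positive:
  assumes I: "I \<subseteq> {..<n}" "card I = 3" "independent E I"
    and vert: "{x, y, u, v} \<subseteq> {..<n} - I"
    and twins: "\<And>l. l \<in> I \<Longrightarrow> E l x \<longleftrightarrow> E l y" "\<And>l. l \<in> I \<Longrightarrow> E l u \<longleftrightarrow> E l v"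
    and neq: "x \<noteq> y" "u \<noteq> v" "{x, y} \<noteq> {u, v}"
  shows "\<exists>s t. 0 < - of_bool (E x y) * s\<^sup>2 + s * t * (of_bool (E x u) - of_bool (E x v) - of_bool (E y u) + of_bool (E y v))
    - of_bool (E u v) * (t::real)\<^sup>2"
proof -
  obtain a where a: "bij_betw a {..<3::nat} I"
    using I(2) ex_bij_betw_nat_finite[of I] by (metis card.infinite lessThan_atLeast0 zero_neq_numeral)
  then have a_mem: "j < 3 \<Longrightarrow> a j \<in> I" and inj: "inj_on a {..<3}" for j by (auto simp: bij_betw_def)
  define d1 where "d1 = (\<lambda>i. unit_fun x i - unit_fun y i)"
  define d2 where "d2 = (\<lambda>i. unit_fun u i - unit_fun v i)"
  have "\<exists>s t. 0 < s\<^sup>2 * adj_form n E d1 d1 + 2 * s * t * adj_form n E d1 d2 + t\<^sup>2 * adj_form n E d2 d2"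
  proof (rule indefinite_on_kernel_of_independent3[OF inj])
    fix j k :: nat assume "j < 3" "k < 3"
    then have "j = k \<or> a j \<noteq> a k" using inj by (auto simp: inj_on_def)
    then show "\<not> E (a j) (a k)"
      using I(3) a_mem[OF \<open>j < 3\<close>] a_mem[OF \<open>k < 3\<close>] by (auto simp: independent_def)
  next
    fix j :: nat assume j: "j < 3"
    show "a j < n" using a_mem[OF j] I(1) by auto
    show "d1 (a j) = 0" "d2 (a j) = 0" using a_mem[OF j] vert by (auto simp: d1_def d2_def unit_fun_def)
    show "adj_form n E (unit_fun (a j)) d1 = 0" "adj_form n E (unit_fun (a j)) d2 = 0"
      using twins a_mem[OF j] by (simp_all add: d1_def d2_def adj_form_diff)
  next
    fix s t assume *: "\<forall>i<n. s * d1 i + t * d2 i = 0"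
    have eqs: "s * d1 x + t * d2 x = 0" "s * d1 y + t * d2 y = 0" "s * d1 u + t * d2 u = 0" "s * d1 v + t * d2 v = 0"
      using * vert by blast+
    then show "s = 0 \<and> t = 0"
      using neq by (auto simp: d1_def d2_def unit_fun_def doubleton_eq_iff of_bool_def split: if_splits)
  qed
  then obtain s t where st: "0 < s\<^sup>2 * adj_form n E d1 d1 + 2 * s * t * adj_form n E d1 d2 + t\<^sup>2 * adj_form n E d2 d2"
    by blast
  have gram: "adj_form n E d1 d1 = - 2 * of_bool (E x y)" "adj_form n E d2 d2 = - 2 * of_bool (E u v)"
    "adj_form n E d1 d2 = of_bool (E x u) - of_bool (E x v) - of_bool (E y u) + of_bool (E y v)"
    using sym[of y x] sym[of v u] by (simp_all add: d1_def d2_def adj_form_diff)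
  have double: "s\<^sup>2 * (- 2 * p) + 2 * s * t * b + t\<^sup>2 * (- 2 * q) = 2 * (- p * s\<^sup>2 + s * t * b - q * t\<^sup>2)"
    for p q b by (simp add: algebra_simps)
  have halve: "0 < - p * s\<^sup>2 + s * t * b - q * t\<^sup>2"
    if "0 < s\<^sup>2 * (- 2 * p) + 2 * s * t * b + t\<^sup>2 * (- 2 * q)" for p q b
    using that unfolding double by (rule zero_less_mult_pos) simp
  show ?thesis by (intro exI[of _ s] exI[of _ t]) (rule halve[OF st[unfolded gram]])
qed

text \<open>Vertices off \<open>I\<close> are sorted by their neighbourhood in \<open>I\<close>,
  nonempty by maximality. Deleting one vertex removes the only possible edge between twins. Then a
  class has at most two vertices, and only one if its neighbourhood is a singleton:
  \<open>3 + 4 * 2 + 1 = 12\<close>.\<close>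

lemma card_le_if_independence_number3:
  assumes W: "W \<subseteq> {..<n}" and I: "I \<subseteq> W" "card I = 3" "independent E I"
    and max: "\<And>J. J \<subseteq> W \<Longrightarrow> independent E J \<Longrightarrow> card J \<le> 3"
  shows "card W \<le> 15"
proof -
  have finW: "finite W" using W by (rule finite_subset) simp
  then have finI: "finite I" using I by (auto dest: finite_subset)
  define T where "T x = {l \<in> I. E l x}" for x
  have T_eq: "E l x \<longleftrightarrow> E l y" if "T x = T y" "l \<in> I" for x y l using that by (auto simp: T_def)
  have I': "I \<subseteq> {..<n}" using I W by auto
  \<comment> \<open>Two twin edges would give the form
    \<open>- s\<^sup>2 + s * t * b - t\<^sup>2\<close> with \<open>b\<close> between -2 and 2, which
    is never positive.\<close>
  have edge_unique: "{x, y} = {u, v}"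
    if "{x, y, u, v} \<subseteq> W - I" "T x = T y" "T u = T v" "E x y" "E u v" for x y u v
  proof (rule ccontr)
    assume neq: "{x, y} \<noteq> {u, v}"
    have vert: "{x, y, u, v} \<subseteq> {..<n} - I" using that(1) W by auto
    note edges = that(4,5)
    have xy: "x \<noteq> y" and uv: "u \<noteq> v" using edges by auto
    from twin_differences_positive[OF I' I(2,3) vert T_eq[OF that(2)] T_eq[OF that(3)] xy uv neq]
    obtain s t :: real where st: "0 < - s\<^sup>2 + s * t * (of_bool (E x u) - of_bool (E x v) - of_bool (E y u) + of_bool (E y v)) - t\<^sup>2"
      using edges by auto
    define b :: real where "b = of_bool (E x u) - of_bool (E x v) - of_bool (E y u) + of_bool (E y v)"
    have b: "\<bar>b\<bar> \<le> 2" by (auto simp: b_def)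
    have "s * t * b \<le> \<bar>s * t\<bar> * \<bar>b\<bar>" by (metis abs_ge_self abs_mult)
    also have "\<dots> \<le> \<bar>s * t\<bar> * 2" using b by (intro mult_left_mono) auto
    also have "\<dots> = 2 * \<bar>s\<bar> * \<bar>t\<bar>" by (simp add: abs_mult)
    also have "\<dots> \<le> s\<^sup>2 + t\<^sup>2" using sum_squares_bound[of "\<bar>s\<bar>" "\<bar>t\<bar>"] by simp
    finally show False using st unfolding b_def by simp
  qed
  \<comment> \<open>For pairwise nonadjacent twins the form vanishes on the plane of
    \<open>x - y\<close> and \<open>x - z\<close>.\<close>
  have no_triple: False
    if "{x, y, z} \<subseteq> W - I" "x \<noteq> y" "x \<noteq> z" "y \<noteq> z" "T x = T y" "T x = T z" "\<not> E x y" "\<not> E x z" "\<not> E y z" for x y z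
  proof -
    have vert: "{x, y, x, z} \<subseteq> {..<n} - I" using that(1) W by auto
    have neq: "{x, y} \<noteq> {x, z}" using that(2-4) by (auto simp: doubleton_eq_iff)
    have "\<not> E y x" using that(7) sym by blast
    with twin_differences_positive[OF I' I(2,3) vert T_eq[OF that(5)] T_eq[OF that(6)] that(2,3) neq]
    show False using that(7-9) by simp
  qed
  obtain R where R: "R \<subseteq> W - I" "card (W - I) \<le> Suc (card R)"
    and R_twins: "\<And>x y. x \<in> R \<Longrightarrow> y \<in> R \<Longrightarrow> T x = T y \<Longrightarrow> \<not> E x y"
  proof (cases "\<exists>x\<in>W - I. \<exists>y\<in>W - I. T x = T y \<and> E x y")
    case True
    then obtain x y where xy: "x \<in> W - I" "y \<in> W - I" "T x = T y" "E x y" by blast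
    show thesis
    proof (rule that[of "W - I - {x}"])
      show "card (W - I) \<le> Suc (card (W - I - {x}))" using xy(1) finW by (simp add: card_Suc_Diff1)
      fix u v assume "u \<in> W - I - {x}" "v \<in> W - I - {x}" "T u = T v"
      then show "\<not> E u v" using edge_unique[of x y u v] xy by blast
    qed auto
  qed (use that[of "W - I"] in auto)
  have finR: "finite R" using R(1) finW by (auto dest: finite_subset)
  have T_nonempty: "T x \<noteq> {}" if "x \<in> W - I" for x
  proof
    assume "T x = {}"
    then have "\<not> E l x" "\<not> E x l" if "l \<in> I" for l using that sym[of x l] by (auto simp: T_def)
    then have "independent E (insert x I)" using I(3) by (auto simp: independent_def)
    from max[OF _ this] show False using that I finI by auto
  qed
  define C where "C S = {x \<in> R. T x = S}" for S
  have finC: "finite (C S)" for S using finR by (simp add: C_def)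
  \<comment> \<open>Two nonadjacent twins with a single neighbour in \<open>I\<close> could replace
    that neighbour, giving a larger independent set.\<close>
  have C1: "card (C S) \<le> 1" if S: "S \<subseteq> I" "card S = 1" for S
  proof (rule ccontr)
    assume "\<not> ?thesis"
    then obtain X where "X \<subseteq> C S" "card X = 2" using obtain_subset_with_card_n[of 2 "C S"] by auto
    then obtain x y where xy: "x \<in> C S" "y \<in> C S" "x \<noteq> y" by (auto simp: card_2_iff)
    then have x: "x \<in> W - I" "T x = S" and y: "y \<in> W - I" "T y = S" and nxy: "\<not> E x y" "\<not> E y x"
      using R(1) R_twins by (auto simp: C_def)
    have nI: "\<not> E l x" "\<not> E x l" "\<not> E l y" "\<not> E y l" if "l \<in> I - S" for l
      using that x(2) y(2) sym[of x l] sym[of y l] by (auto simp: T_def)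
    then have "independent E ({x, y} \<union> (I - S))"
      using I(3) nxy unfolding independent_def by blast
    from max[OF _ this] have "card ({x, y} \<union> (I - S)) \<le> 3" using x y I by auto
    moreover have "card ({x, y} \<union> (I - S)) = card {x, y} + card (I - S)"
      using x y finI by (intro card_Un_disjoint) auto
    moreover have "card (I - S) = 2" using S I finI by (simp add: card_Diff_subset finite_subset)
    ultimately show False using xy(3) by simp
  qed
  have C2: "card (C S) \<le> 2" for S
  proof (rule ccontr)
    assume "\<not> ?thesis"
    then obtain X where X: "X \<subseteq> C S" "card X = 3" using obtain_subset_with_card_n[of 3 "C S"] by auto
    then obtain x y z where "X = {x, y, z}" "x \<noteq> y" "x \<noteq> z" "y \<noteq> z" by (metis card_3_iff)
    with X(1) show False using no_triple[of x y z] R(1) R_twins by (auto simp: C_def)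
  qed
  have "card R \<le> (\<Sum>S\<in>Pow I - {{}}. card (C S))"
  proof -
    have "R = (\<Union>S\<in>Pow I - {{}}. C S)" using T_nonempty R(1) by (auto simp: C_def T_def)
    then show ?thesis using card_UN_le[of "Pow I - {{}}" C] finI by simp
  qed
  also have "\<dots> \<le> (\<Sum>S\<in>Pow I - {{}}. if card S = 1 then 1 else 2)"
    using C1 C2 by (intro sum_mono) auto
  also have "\<dots> = 11"
  proof -
    let ?P = "Pow I - {{}}"
    have finP: "finite ?P" and card_P: "card ?P = 7" using finI I(2) by (simp_all add: card_Pow)
    have "{S \<in> ?P. card S = 1} = {S. S \<subseteq> I \<and> card S = 1}" by auto
    then have "card {S \<in> ?P. card S = 1} = 3" using n_subsets[OF finI, of 1] I(2) by simp
    moreover have "(\<Sum>S\<in>?P. if card S = 1 then 1 else 2) + (\<Sum>S\<in>?P. if card S = 1 then 1 else 0) = (\<Sum>S\<in>?P. 2::nat)"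
      unfolding sum.distrib[symmetric] by (intro sum.cong) auto
    moreover have "(\<Sum>S\<in>?P. if card S = 1 then 1 else 0) = card {S \<in> ?P. card S = 1}"
      unfolding card_eq_sum by (rule sum.inter_filter[OF finP, symmetric])
    ultimately show ?thesis using card_P by simp
  qed
  finally have "card (W - I) \<le> 12" using R(2) by simp
  then show ?thesis using I(1,2) finI by (simp add: card_Diff_subset)
qed

end

subsection \<open>Independence number four\<close>

text \<open>
  The binary digits of \<open>u < 8\<close> are the coordinates of a cube vertex. The hypotheses come from the six
  faces and the six diagonal rectangles; a weighted sum of all of them shows that they are tight.
\<close>

lemma cube_inequalities:
  fixes r :: "nat \<Rightarrow> nat \<Rightarrow> int"
  assumes bounds: "\<And>x y. 0 \<le> r x y \<and> r x y \<le> 1"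
    and "1 \<le> r 0 3 + r 1 2 - r 0 1 - r 0 2 - r 1 3 - r 2 3"
    and "1 \<le> r 4 7 + r 5 6 - r 4 5 - r 4 6 - r 5 7 - r 6 7"
    and "1 \<le> r 0 5 + r 1 4 - r 0 1 - r 0 4 - r 1 5 - r 4 5"
    and "1 \<le> r 2 7 + r 3 6 - r 2 3 - r 2 6 - r 3 7 - r 6 7"
    and "1 \<le> r 0 6 + r 2 4 - r 0 2 - r 0 4 - r 2 6 - r 4 6"
    and "1 \<le> r 1 7 + r 3 5 - r 1 3 - r 1 5 - r 3 7 - r 5 7"
    and "1 \<le> r 0 7 + r 3 4 - r 0 3 - r 0 4 - r 3 7 - r 4 7"
    and "1 \<le> r 1 6 + r 2 5 - r 1 2 - r 1 5 - r 2 6 - r 5 6"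
    and "1 \<le> r 0 7 + r 2 5 - r 0 2 - r 0 5 - r 2 7 - r 5 7"
    and "1 \<le> r 1 6 + r 3 4 - r 1 3 - r 1 4 - r 3 6 - r 4 6"
    and "1 \<le> r 0 7 + r 1 6 - r 0 1 - r 0 6 - r 1 7 - r 6 7"
    and "1 \<le> r 2 5 + r 3 4 - r 2 3 - r 2 4 - r 3 5 - r 4 5"
  shows "r 0 4 = 0 \<and> r 0 7 = 1 \<and> r 0 6 + r 2 4 = 1 \<and> r 0 3 + r 4 7 = 1"
  using assms(2-) bounds[of 0 1] bounds[of 0 2] bounds[of 0 3] bounds[of 0 4] bounds[of 0 5] bounds[of 0 6]
    bounds[of 0 7] bounds[of 1 2] bounds[of 1 3] bounds[of 1 4] bounds[of 1 5] bounds[of 1 6] bounds[of 1 7]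
    bounds[of 2 3] bounds[of 2 4] bounds[of 2 5] bounds[of 2 6] bounds[of 2 7] bounds[of 3 4] bounds[of 3 5]
    bounds[of 3 6] bounds[of 3 7] bounds[of 4 5] bounds[of 4 6] bounds[of 4 7] bounds[of 5 6] bounds[of 5 7]
    bounds[of 6 7]
  by (intro conjI) (smt (verit))+

text \<open>Up to complement there are only three nonconstant Boolean triples.\<close>

lemma no_four_noncomplementary_triples:
  assumes "a1 \<noteq> a2 \<or> a1 \<noteq> a3" "b1 \<noteq> b2 \<or> b1 \<noteq> b3" "c1 \<noteq> c2 \<or> c1 \<noteq> c3" "d1 \<noteq> d2 \<or> d1 \<noteq> d3"
    and "a1 \<noteq> b1 \<or> a2 \<noteq> b2 \<or> a3 \<noteq> b3" "a1 = b1 \<or> a2 = b2 \<or> a3 = b3"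
    and "a1 \<noteq> c1 \<or> a2 \<noteq> c2 \<or> a3 \<noteq> c3" "a1 = c1 \<or> a2 = c2 \<or> a3 = c3"
    and "a1 \<noteq> d1 \<or> a2 \<noteq> d2 \<or> a3 \<noteq> d3" "a1 = d1 \<or> a2 = d2 \<or> a3 = d3"
    and "b1 \<noteq> c1 \<or> b2 \<noteq> c2 \<or> b3 \<noteq> c3" "b1 = c1 \<or> b2 = c2 \<or> b3 = c3"
    and "b1 \<noteq> d1 \<or> b2 \<noteq> d2 \<or> b3 \<noteq> d3" "b1 = d1 \<or> b2 = d2 \<or> b3 = d3"
    and "c1 \<noteq> d1 \<or> c2 \<noteq> d2 \<or> c3 \<noteq> d3" "c1 = d1 \<or> c2 = d2 \<or> c3 = (d3::bool)"
  shows False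
  using assms by (smt (verit))

text \<open>
  \<open>M\<close> collects the nonempty subsets of the independent set \<open>I\<close> that are not neighbourhoods, and \<open>R\<close> is
  the adjacency of the vertices with the given neighbourhoods. The empty set stands for an additional
  isolated vertex, so that disjoint unions are degenerate parallelograms.
\<close>

locale parallelogram_types =
  fixes I :: "'a set" and M :: "'a set set" and R :: "'a set \<Rightarrow> 'a set \<Rightarrow> bool"
  assumes card_I: "card I = 4" and card_M: "card M \<le> 3" and finite_M: "finite M"
    and sym: "R S T \<longleftrightarrow> R T S" and empty: "\<not> R {} S" and empty_M: "{} \<notin> M"
    and parallelogram: "\<lbrakk>\<And>S. S \<in> {S1, S2, S3, S4} \<Longrightarrow> S \<subseteq> I \<and> S \<notin> M; distinct [S1, S2, S3, S4];
      S1 \<inter> S2 = S3 \<inter> S4; S1 \<union> S2 = S3 \<union> S4\<rbrakk> \<Longrightarrow>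
      (1::int) \<le> of_bool (R S1 S2) + of_bool (R S3 S4) - of_bool (R S1 S3) - of_bool (R S1 S4)
        - of_bool (R S3 S2) - of_bool (R S4 S2)"
begin

text \<open>The degenerate parallelogram with diagonals \<open>S\<close>, \<open>T\<close> and
  \<open>{}\<close>, \<open>S \<union> T\<close>: edges at \<open>{}\<close> being absent, the
  inequality can only hold in one way.\<close>

lemma disjoint_union:
  assumes "S \<noteq> {}" "T \<noteq> {}" "S \<inter> T = {}" "S \<union> T \<subseteq> I" "S \<notin> M" "T \<notin> M" "S \<union> T \<notin> M"
  shows "R S T" "\<not> R S (S \<union> T)" "\<not> R T (S \<union> T)"
proof -
  have "(1::int) \<le> of_bool (R S T) + of_bool (R {} (S \<union> T)) - of_bool (R S {}) - of_bool (R S (S \<union> T))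
        - of_bool (R {} T) - of_bool (R (S \<union> T) T)"
    using assms empty_M by (intro parallelogram) auto
  then show "R S T" "\<not> R S (S \<union> T)" "\<not> R T (S \<union> T)"
    using sym[of T "S \<union> T"] by (auto simp: of_bool_def empty split: if_splits)
qed

text \<open>Faces and diagonal rectangles of the parallelepiped are parallelograms, so
  \<open>cube_inequalities\<close> applies to its eight corners. The step from \<open>X0\<close> to
  \<open>X1\<close> may both add and remove elements, while \<open>Y\<close> and \<open>Z\<close>
  are only added.\<close>

lemma cube:
  assumes X: "X0 \<noteq> X1" and Y: "Y \<noteq> {}" "Y \<inter> (X0 \<union> X1) = {}" and Z: "Z \<noteq> {}" "Z \<inter> (X0 \<union> X1) = {}" "Y \<inter> Z = {}"
    and present: "\<And>i j k. (if i then X1 else X0) \<union> (if j then Y else {}) \<union> (if k then Z else {}) \<notin> M"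
    and I: "X0 \<union> X1 \<union> Y \<union> Z \<subseteq> I"
  shows "\<not> R X0 X1" "R X0 (X1 \<union> Y \<union> Z)" "R X0 (X1 \<union> Y) \<noteq> R (X0 \<union> Y) X1"
    "R X0 (X0 \<union> Y \<union> Z) \<noteq> R X1 (X1 \<union> Y \<union> Z)"
proof -
  define P where "P i j k = (if i then X1 else X0) \<union> (if j then Y else {}) \<union> (if k then Z else {})" for i j k
  have P_inj: "P i j k = P i' j' k' \<longleftrightarrow> i = i' \<and> j = j' \<and> k = k'" for i j k i' j' k'
  proof
    assume eq: "P i j k = P i' j' k'"
    obtain y z where "y \<in> Y" "z \<in> Z" using Y Z by blast
    then have "y \<in> P i j k \<longleftrightarrow> j" "z \<in> P i j k \<longleftrightarrow> k" "y \<in> P i' j' k' \<longleftrightarrow> j'" "z \<in> P i' j' k' \<longleftrightarrow> k'"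
      using Y Z by (auto simp: P_def)
    moreover have "P i j k - (Y \<union> Z) = (if i then X1 else X0)" "P i' j' k' - (Y \<union> Z) = (if i' then X1 else X0)"
      using Y Z by (auto simp: P_def)
    ultimately show "i = i' \<and> j = j' \<and> k = k'" using eq X by (metis (full_types))
  qed simp
  have ok: "P i j k \<subseteq> I \<and> P i j k \<notin> M" for i j k
    using present I by (auto simp: P_def)
  \<comment> \<open>From the highest binary digit to the lowest: the choice of \<open>X0\<close> or
    \<open>X1\<close>, then \<open>Y\<close>, then \<open>Z\<close>.\<close>
  define p where "p u = P (4 \<le> u) (2 \<le> u mod 4) (odd u)" for u :: nat
  define r :: "nat \<Rightarrow> nat \<Rightarrow> int" where "r u v = of_bool (R (p u) (p v))" for u v
  have p: "p 0 = P False False False" "p 1 = P False False True" "p 2 = P False True False" "p 3 = P False True True"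
    "p 4 = P True False False" "p 5 = P True False True" "p 6 = P True True False" "p 7 = P True True True"
    by (simp_all add: p_def)
  have para: "1 \<le> r u v + r w z - r u w - r u z - r w v - r z v"
    if "distinct [p u, p v, p w, p z]" "p u \<inter> p v = p w \<inter> p z" "p u \<union> p v = p w \<union> p z" for u v w z
    unfolding r_def by (rule parallelogram) (use ok that in \<open>auto simp: p_def\<close>)
  have bounds: "0 \<le> r u v \<and> r u v \<le> 1" for u v by (simp add: r_def)
  have sets: "P False j k = X0 \<union> (if j then Y else {}) \<union> (if k then Z else {})"
    "P True j k = X1 \<union> (if j then Y else {}) \<union> (if k then Z else {})" for j k by (simp_all add: P_def)
  have "r 0 4 = 0 \<and> r 0 7 = 1 \<and> r 0 6 + r 2 4 = 1 \<and> r 0 3 + r 4 7 = 1"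
    by (rule cube_inequalities[OF bounds]; rule para; unfold p;
        (simp add: P_inj; fail)?; (unfold sets; use Y Z in auto)?)
  then show "\<not> R X0 X1" "R X0 (X1 \<union> Y \<union> Z)" "R X0 (X1 \<union> Y) \<noteq> R (X0 \<union> Y) X1"
    "R X0 (X0 \<union> Y \<union> Z) \<noteq> R X1 (X1 \<union> Y \<union> Z)"
    by (auto simp: r_def p sets of_bool_def split: if_splits)
qed

text \<open>A complete cube with corner \<open>{}\<close> would force an edge from \<open>{}\<close>
  to the opposite corner, but \<open>{}\<close> is isolated.\<close>

lemma no_lattice:
  assumes "A \<noteq> {}" "B \<noteq> {}" "C \<noteq> {}" "A \<inter> B = {}" "A \<inter> C = {}" "B \<inter> C = {}" "A \<union> B \<union> C \<subseteq> I"
  shows "\<exists>i j k. (if i then A else {}) \<union> (if j then B else {}) \<union> (if k then C else {}) \<in> M"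
proof (rule ccontr)
  assume "\<not> ?thesis"
  then have "R {} (A \<union> B \<union> C)" using assms by (intro cube(2)) auto
  then show False by (simp add: empty)
qed

section \<open>How the missing subsets meet the elements of \<open>I\<close>\<close>

lemma not_four_missing:
  assumes "S1 \<in> M" "S2 \<in> M" "S3 \<in> M" "S4 \<in> M" "distinct [S1, S2, S3, S4]"
  shows False
proof -
  have "card {S1, S2, S3, S4} \<le> card M" using assms finite_M by (intro card_mono) auto
  moreover have "card {S1, S2, S3, S4} = 4" using assms(5) by simp
  ultimately show False using card_M by simp
qed

text \<open>If every set containing \<open>a\<close> were present, cubes of such sets would force
  edges that disjoint unions with \<open>{a}\<close> or \<open>{a, z}\<close> forbid. The only
  escape is that \<open>{b, c, d}\<close> and its three two-element subsets are all missing, one set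
  too many.\<close>

lemma missing_covers:
  assumes I: "I = {a, b, c, d}" and dist: "distinct [a, b, c, d]"
  shows "\<exists>S\<in>M. a \<in> S"
proof (rule ccontr)
  assume *: "\<not> ?thesis"
  then have a: "S \<notin> M" if "a \<in> S" for S using that by blast
  have pair: "{x, y} \<in> M" if xyz: "{a, x, y, z} = I" "distinct [a, x, y, z]" for x y z
  proof (rule ccontr)
    assume xy: "{x, y} \<notin> M"
    have "R {a} ({a} \<union> {x} \<union> {y}) \<noteq> R {a, z} ({a, z} \<union> {x} \<union> {y})"
      using xyz a by (intro cube(4)) auto
    moreover have "\<not> R {a} ({a} \<union> {x, y})"
      by (rule disjoint_union(2)) (use xyz a xy in auto)
    moreover have "\<not> R {a, z} ({a, z} \<union> {x, y})"
      by (rule disjoint_union(2)) (use xyz a xy in auto)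
    ultimately show False by (simp add: insert_commute)
  qed
  have "{b, c, d} \<in> M"
  proof (rule ccontr)
    assume bcd: "{b, c, d} \<notin> M"
    have "R {a} ({a, b} \<union> {c} \<union> {d})" using I dist a by (intro cube(2)) auto
    moreover have "\<not> R {a} ({a} \<union> {b, c, d})" using I dist a bcd by (intro disjoint_union(2)) auto
    ultimately show False by (simp add: insert_commute)
  qed
  moreover have "{b, c} \<in> M" "{b, d} \<in> M" "{c, d} \<in> M"
    using pair[of b c d] pair[of b d c] pair[of c d b] I dist by auto
  moreover have "d \<notin> {b, c}" "c \<notin> {b, d}" "b \<notin> {c, d}" using dist by auto
  then have "distinct [{b, c, d}, {b, c}, {b, d}, {c, d}]"
    unfolding distinct.simps list.set by (blast elim: equalityE)
  ultimately show False by (rule not_four_missing)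
qed

text \<open>The subsets of \<open>{b, c, d}\<close> form a cube with corner
  \<open>{}\<close>.\<close>

lemma missing_avoids:
  assumes I: "I = {a, b, c, d}" and dist: "distinct [a, b, c, d]"
  shows "\<exists>S\<in>M. a \<notin> S"
proof -
  have "\<exists>i j k. (if i then {b} else {}) \<union> (if j then {c} else {}) \<union> (if k then {d} else {}) \<in> M"
    by (rule no_lattice) (use I dist in auto)
  then obtain i j k where "(if i then {b} else {}) \<union> (if j then {c} else {}) \<union> (if k then {d} else {}) \<in> M"
    (is "?S \<in> M") by blast
  moreover have "a \<notin> ?S" using dist by simp
  ultimately show ?thesis by (rule rev_bexI)
qed

text \<open>Otherwise the whole cube from \<open>{a}\<close> to \<open>{b}\<close> in the directions
  \<open>c\<close> and \<open>d\<close> is present. Its conclusions contradict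
  \<open>disjoint_union\<close> unless \<open>{a, b}\<close>, \<open>{c, d}\<close>,
  \<open>{a, b, c}\<close> and \<open>{a, b, d}\<close> are all missing.\<close>

lemma missing_separates:
  assumes I: "I = {a, b, c, d}" and dist: "distinct [a, b, c, d]"
  shows "\<exists>S\<in>M. a \<in> S \<longleftrightarrow> b \<notin> S"
proof (rule ccontr)
  assume "\<not> ?thesis"
  then have ab: "S \<notin> M" if "a \<in> S \<longleftrightarrow> b \<notin> S" for S using that by blast
  have nm: "{a} \<notin> M" "{b} \<notin> M" "{a, c, d} \<notin> M" "{b, c, d} \<notin> M"
    using dist by (auto intro!: ab)
  have present: "(if i then {b} else {a}) \<union> (if j then {x} else {}) \<union> (if k then {y} else {}) \<notin> M"
    if "x \<in> {c, d}" "y \<in> {c, d}" for i j k x y using that dist by (intro ab) auto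
  have "{a, b} \<in> M"
  proof (rule ccontr)
    assume ab': "{a, b} \<notin> M"
    have "R {a} {b}" using I dist ab' nm by (intro disjoint_union(1)) (simp_all add: insert_commute)
    moreover have "\<not> R {a} {b}"
      using I dist present by (intro cube(1)[of _ _ "{c}" "{d}"]) auto
    ultimately show False by blast
  qed
  moreover have "{c, d} \<in> M"
  proof (rule ccontr)
    assume cd: "{c, d} \<notin> M"
    have "R {a} ({a} \<union> {c} \<union> {d}) \<noteq> R {b} ({b} \<union> {c} \<union> {d})"
      using I dist present by (intro cube(4)) auto
    moreover have "\<not> R {a} ({a} \<union> {c, d})"
      by (rule disjoint_union(2)) (use I dist nm cd in \<open>simp_all add: insert_commute\<close>)
    moreover have "\<not> R {b} ({b} \<union> {c, d})"
      by (rule disjoint_union(2)) (use I dist nm cd in \<open>simp_all add: insert_commute\<close>)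
    ultimately show False by (simp add: insert_commute)
  qed
  moreover have "{a, b, x} \<in> M" if x: "{x, y} = {c, d}" for x y
  proof (rule ccontr)
    assume abx: "{a, b, x} \<notin> M"
    have xy: "x \<noteq> y" "x \<noteq> a" "x \<noteq> b" "y \<noteq> a" "y \<noteq> b" "a \<noteq> b" "x \<in> I" "y \<in> I" "x \<in> {c, d}" "y \<in> {c, d}"
      using x dist I by (auto simp: doubleton_eq_iff)
    have nmx: "{a, x} \<notin> M" "{b, x} \<notin> M" using xy by (auto intro!: ab)
    have "R {a} ({b} \<union> {x}) \<noteq> R ({a} \<union> {x}) {b}"
      using I xy present[of x y] by (intro cube(3)[of _ _ _ "{y}"]) auto
    moreover have "R {a} {b, x}"
      by (rule disjoint_union(1)) (use I xy nm nmx abx in \<open>simp_all add: insert_commute\<close>)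
    moreover have "R {a, x} {b}"
      by (rule disjoint_union(1)) (use I xy nm nmx abx in \<open>simp_all add: insert_commute\<close>)
    ultimately show False by (simp add: insert_commute)
  qed
  from this[of c d] this[of d c] have "{a, b, c} \<in> M" "{a, b, d} \<in> M" by (simp_all add: insert_commute)
  moreover have "a \<notin> {c, d}" "c \<notin> {a, b}" "d \<notin> {a, b}" "c \<notin> {a, b, d}" using dist by auto
  then have "distinct [{a, b}, {c, d}, {a, b, c}, {a, b, d}]"
    unfolding distinct.simps list.set by (blast elim: equalityE)
  ultimately show False by (rule not_four_missing)
qed

text \<open>The sets that treat \<open>a\<close> and \<open>b\<close> alike form a cube with corner
  \<open>{}\<close>.\<close>

lemma missing_unites:
  assumes I: "I = {a, b, c, d}" and dist: "distinct [a, b, c, d]"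
  shows "\<exists>S\<in>M. a \<in> S \<longleftrightarrow> b \<in> S"
proof -
  have "\<exists>i j k. (if i then {a, b} else {}) \<union> (if j then {c} else {}) \<union> (if k then {d} else {}) \<in> M"
    by (rule no_lattice) (use I dist in auto)
  then obtain i j k where "(if i then {a, b} else {}) \<union> (if j then {c} else {}) \<union> (if k then {d} else {}) \<in> M"
    (is "?S \<in> M") by blast
  moreover have "a \<in> ?S \<longleftrightarrow> b \<in> ?S" using dist by simp
  ultimately show ?thesis by (rule rev_bexI)
qed

text \<open>Each element of \<open>I\<close> is encoded by its memberships in the at most three
  missing sets. The preceding lemmas make these triples nonconstant, pairwise distinct and pairwise
  noncomplementary, which is impossible for four elements.\<close>

lemma contradiction: False
proof -
  obtain a b c d where I: "I = {a, b, c, d}" and dist: "distinct [a, b, c, d]"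
    using card_I by (auto simp: card_Suc_eq numeral_eq_Suc)
  have perms: "I = {b, a, c, d}" "I = {c, a, b, d}" "I = {d, a, b, c}" "I = {a, c, b, d}" "I = {a, d, b, c}"
    "I = {b, c, a, d}" "I = {b, d, a, c}" "I = {c, d, a, b}" using I by auto
  have "M \<noteq> {}" using missing_covers[OF I dist] by blast
  \<comment> \<open>A smaller \<open>M\<close> is listed with repetitions.\<close>
  then obtain X Y Z where M: "M = {X, Y, Z}"
  proof -
    assume *: "\<And>X Y Z. M = {X, Y, Z} \<Longrightarrow> thesis"
    have "card M = 1 \<or> card M = 2 \<or> card M = 3" using \<open>M \<noteq> {}\<close> card_M finite_M
      by (metis One_nat_def card_0_eq le_SucE le_zero_eq numeral_2_eq_2 numeral_3_eq_3)
    then show thesis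
    proof (elim disjE)
      assume "card M = 1"
      then obtain X where "M = {X, X, X}" by (auto simp: card_1_singleton_iff)
      then show thesis by (rule *)
    next
      assume "card M = 2"
      then obtain X Y where "M = {X, Y, Y}" by (auto simp: card_2_iff)
      then show thesis by (rule *)
    next
      assume "card M = 3"
      then show thesis using * by (auto simp: card_3_iff)
    qed
  qed
  have mixed: "(i \<in> X) \<noteq> (i \<in> Y) \<or> (i \<in> X) \<noteq> (i \<in> Z)"
    if "I = {i, j, k, l}" "distinct [i, j, k, l]" for i j k l
    using missing_covers[OF that] missing_avoids[OF that] unfolding M by auto
  have sep: "(i \<in> X) \<noteq> (j \<in> X) \<or> (i \<in> Y) \<noteq> (j \<in> Y) \<or> (i \<in> Z) \<noteq> (j \<in> Z)"
    if "I = {i, j, k, l}" "distinct [i, j, k, l]" for i j k l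
    using missing_separates[OF that] unfolding M by auto
  have unite: "(i \<in> X) = (j \<in> X) \<or> (i \<in> Y) = (j \<in> Y) \<or> (i \<in> Z) = (j \<in> Z)"
    if "I = {i, j, k, l}" "distinct [i, j, k, l]" for i j k l
    using missing_unites[OF that] unfolding M by auto
  show False
    by (rule no_four_noncomplementary_triples[of "a \<in> X" "a \<in> Y" "a \<in> Z" "b \<in> X" "b \<in> Y" "b \<in> Z"
          "c \<in> X" "c \<in> Y" "c \<in> Z" "d \<in> X" "d \<in> Y" "d \<in> Z"];
        (rule mixed[OF I] mixed[OF perms(1)] mixed[OF perms(2)] mixed[OF perms(3)]
          sep[OF I] sep[OF perms(4)] sep[OF perms(5)] sep[OF perms(6)] sep[OF perms(7)] sep[OF perms(8)]
          unite[OF I] unite[OF perms(4)] unite[OF perms(5)] unite[OF perms(6)] unite[OF perms(7)] unite[OF perms(8)])?;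
        use dist in auto)
qed

end

context few_nonpos_graph
begin

text \<open>Four independent vertices make the form positive definite on the vectors that vanish on
  \<open>I\<close> and are orthogonal to it. Twins would violate this, so at least twelve of the
  fifteen nonempty subsets of \<open>I\<close> are neighbourhoods, and the same positivity supplies
  the parallelogram inequality.\<close>

lemma card_le_if_independence_number4:
  assumes W: "W \<subseteq> {..<n}" and I: "I \<subseteq> W" "card I = 4" "independent E I"
    and max: "\<And>J. J \<subseteq> W \<Longrightarrow> independent E J \<Longrightarrow> card J \<le> 4"
  shows "card W \<le> 15"
proof (rule ccontr)
  assume large: "\<not> card W \<le> 15"
  have finW: "finite W" using W by (rule finite_subset) simp
  then have finI: "finite I" using I by (auto dest: finite_subset)
  have I': "I \<subseteq> {..<n}" using I W by auto
  obtain a where a: "bij_betw a {..<4::nat} I"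
    using I(2) ex_bij_betw_nat_finite[OF finI] by (auto simp: lessThan_atLeast0)
  then have a_mem: "j < 4 \<Longrightarrow> a j \<in> I" and inj: "inj_on a {..<4}" for j by (auto simp: bij_betw_def)
  have positive_on_kernel: "0 < adj_form n E d d"
    if "\<And>l. l \<in> I \<Longrightarrow> d l = 0" "\<And>l. l \<in> I \<Longrightarrow> adj_form n E (unit_fun l) d = 0" "i < n" "d i \<noteq> 0" for d i
  proof (rule positive_on_kernel_of_independent4[of a d i])
    fix j k :: nat assume "j < 4" "k < 4"
    then show "\<not> E (a j) (a k)"
      using I(3) a_mem[of j] a_mem[of k] irrefl by (metis independent_def)
  qed (use inj a_mem that I' in auto)
  define T where "T x = {l \<in> I. E l x}" for x
  have T_nonempty: "T x \<noteq> {}" if "x \<in> W - I" for x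
  proof
    assume "T x = {}"
    then have "\<not> E l x" "\<not> E x l" if "l \<in> I" for l using that sym[of x l] by (auto simp: T_def)
    then have "independent E (insert x I)" using I(3) by (auto simp: independent_def)
    from max[OF _ this] show False using that I finI by auto
  qed
  have T_inj: "inj_on T (W - I)"
  proof (rule inj_onI, rule ccontr)
    fix x y assume xy: "x \<in> W - I" "y \<in> W - I" "T x = T y" "x \<noteq> y"
    have T_eq: "E l x \<longleftrightarrow> E l y" if "l \<in> I" for l using xy(3) that by (auto simp: T_def)
    have "0 < adj_form n E (\<lambda>i. unit_fun x i - unit_fun y i) (\<lambda>i. unit_fun x i - unit_fun y i)"
    proof (rule positive_on_kernel[of _ x])
      show "unit_fun x l - unit_fun y l = 0" if "l \<in> I" for l
        using that xy by (auto simp: unit_fun_def)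
      show "adj_form n E (unit_fun l) (\<lambda>i. unit_fun x i - unit_fun y i) = 0" if "l \<in> I" for l
        using T_eq[OF that] by (simp add: adj_form_diff)
      show "x < n" using xy W by auto
      show "unit_fun x x - unit_fun y x \<noteq> 0" using xy by simp
    qed
    then show False using sym[of y x] by (simp add: adj_form_diff of_bool_def split: if_splits)
  qed
  define M where "M = Pow I - {{}} - T ` (W - I)"
  have "T ` (W - I) \<subseteq> Pow I - {{}}" using T_nonempty by (auto simp: T_def)
  then have "card M = 15 - card (T ` (W - I))"
    unfolding M_def using finI finW I(2) by (subst card_Diff_subset) (auto simp: card_Pow)
  moreover have "card (T ` (W - I)) = card W - 4"
    using card_image[OF T_inj] I finI by (simp add: card_Diff_subset)
  ultimately have card_M: "card M \<le> 3" using large by simp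
  \<comment> \<open>The empty neighbourhood is represented by the index \<open>n\<close>, where
    there are no edges.\<close>
  define v where "v S = (if S = {} then n else inv_into (W - I) T S)" for S
  define R where "R S S' = E (v S) (v S')" for S S'
  have v: "v S \<in> insert n (W - I)" "T (v S) = S" "v S = n \<longleftrightarrow> S = {}" if "S \<subseteq> I" "S \<notin> M" for S
  proof -
    have Tn: "T n = {}" using support sym by (force simp: T_def)
    have "S = {} \<or> S \<in> T ` (W - I)" using that by (auto simp: M_def)
    then show "v S \<in> insert n (W - I)" "T (v S) = S"
      using Tn inv_into_into[of S T "W - I"] f_inv_into_f[of S T "W - I"] by (auto simp: v_def)
    then show "v S = n \<longleftrightarrow> S = {}" using Tn by (auto simp: v_def)
  qed
  have edge: "E l (v S) \<longleftrightarrow> l \<in> S" if "S \<subseteq> I" "S \<notin> M" "l \<in> I" for l S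
    using v(2)[OF that(1,2)] that(3) by (auto simp: T_def)
  have v_neq: "v S \<noteq> v S'" if "S \<subseteq> I" "S \<notin> M" "S' \<subseteq> I" "S' \<notin> M" "S \<noteq> S'" for S S'
    using v(2)[OF that(1,2)] v(2)[OF that(3,4)] that(5) by metis
  interpret types: parallelogram_types I M R
  proof
    show "card I = 4" "card M \<le> 3" by fact+
    show "finite M" using finI by (simp add: M_def)
    show "R S S' \<longleftrightarrow> R S' S" for S S' by (simp add: R_def sym[of "v S"])
    show "\<not> R {} S" for S using support[of n] by (auto simp: R_def v_def)
    show "{} \<notin> M" by (simp add: M_def)
  next
    fix S1 S2 S3 S4 :: "nat set"
    assume ok: "\<And>S. S \<in> {S1, S2, S3, S4} \<Longrightarrow> S \<subseteq> I \<and> S \<notin> M" and dist: "distinct [S1, S2, S3, S4]"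
      and eq: "S1 \<inter> S2 = S3 \<inter> S4" "S1 \<union> S2 = S3 \<union> S4"
    have ok': "S1 \<subseteq> I" "S1 \<notin> M" "S2 \<subseteq> I" "S2 \<notin> M" "S3 \<subseteq> I" "S3 \<notin> M" "S4 \<subseteq> I" "S4 \<notin> M"
      using ok by auto
    define x1 x2 x3 x4 where x: "x1 = v S1" "x2 = v S2" "x3 = v S3" "x4 = v S4"
    have neq: "x1 \<noteq> x2" "x1 \<noteq> x3" "x1 \<noteq> x4" "x2 \<noteq> x3" "x2 \<noteq> x4" "x3 \<noteq> x4"
      unfolding x using dist ok' by (simp_all add: v_neq)
    have mem: "x1 \<in> insert n (W - I)" "x2 \<in> insert n (W - I)" "x3 \<in> insert n (W - I)" "x4 \<in> insert n (W - I)"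
      using v(1) ok' by (simp_all add: x)
    then have offI: "x1 \<notin> I" "x2 \<notin> I" "x3 \<notin> I" "x4 \<notin> I" using I' by auto
    define d where "d = (\<lambda>i. unit_fun x1 i + unit_fun x2 i - unit_fun x3 i - unit_fun x4 i)"
    \<comment> \<open>At most one of the two is the artificial vertex \<open>n\<close>; the other
      one witnesses that \<open>d\<close> is nonzero.\<close>
    obtain i where i: "i < n" "i = x1 \<or> i = x2"
      using mem(1,2) neq(1) W by auto
    have "0 < adj_form n E d d"
    proof (rule positive_on_kernel[OF _ _ i(1)])
      show "d l = 0" if "l \<in> I" for l using that offI by (auto simp: d_def unit_fun_def)
      show "adj_form n E (unit_fun l) d = 0" if "l \<in> I" for l
      proof -
        have "adj_form n E (unit_fun l) d = of_bool (l \<in> S1) + of_bool (l \<in> S2) - of_bool (l \<in> S3) - of_bool (l \<in> S4)"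
          using that ok' by (simp add: d_def adj_form_add adj_form_diff x edge)
        moreover have "l \<in> S1 \<and> l \<in> S2 \<longleftrightarrow> l \<in> S3 \<and> l \<in> S4" "l \<in> S1 \<or> l \<in> S2 \<longleftrightarrow> l \<in> S3 \<or> l \<in> S4"
          using eq by blast+
        ultimately show ?thesis by (auto simp: of_bool_def)
      qed
      show "d i \<noteq> 0" using i(2) neq by (auto simp: d_def unit_fun_def)
    qed
    \<comment> \<open>The value is twice an integer, so positivity means that this integer is at
      least 1.\<close>
    also have "adj_form n E d d = 2 * of_int (of_bool (E x1 x2) + of_bool (E x3 x4) - of_bool (E x1 x3) - of_bool (E x1 x4)
        - of_bool (E x3 x2) - of_bool (E x4 x2))"
      using sym[of x2 x1] sym[of x3 x1] sym[of x4 x1] sym[of x2 x3] sym[of x2 x4] sym[of x4 x3]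
      by (simp add: d_def adj_form_add adj_form_diff)
    finally have "0 < (of_bool (E x1 x2) + of_bool (E x3 x4) - of_bool (E x1 x3) - of_bool (E x1 x4)
        - of_bool (E x3 x2) - of_bool (E x4 x2) :: int)"
      by (simp only: zero_less_mult_iff of_int_0_less_iff) simp
    then show "(1::int) \<le> of_bool (R S1 S2) + of_bool (R S3 S4) - of_bool (R S1 S3) - of_bool (R S1 S4)
        - of_bool (R S3 S2) - of_bool (R S4 S2)"
      by (simp add: R_def x)
  qed
  show False by (rule types.contradiction)
qed

section \<open>Combining the cases of the independence number\<close>

lemma card_vertices_le:
  assumes W: "W \<subseteq> {..<n}"
  shows "card W \<le> 15"
proof -
  have finW: "finite W" using W by (rule finite_subset) simp
  define \<A> where "\<A> = {J. J \<subseteq> W \<and> independent E J}"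
  have "finite \<A>" "\<A> \<noteq> {}" using finW by (auto simp: \<A>_def independent_def)
  then have "Max (card ` \<A>) \<in> card ` \<A>" by (intro Max_in) auto
  then obtain I where I: "I \<in> \<A>" "card I = Max (card ` \<A>)" by auto
  have max: "card J \<le> card I" if "J \<in> \<A>" for J
    unfolding I(2) using \<open>finite \<A>\<close> that by (intro Max_ge) auto
  have IW: "I \<subseteq> W" "independent E I" using I by (auto simp: \<A>_def)
  have max': "card J \<le> card I" if "J \<subseteq> W" "independent E J" for J using max that by (simp add: \<A>_def)
  consider "card I \<le> 2" | "card I = 3" | "card I = 4" | "card I \<ge> 5" by linarith
  then show ?thesis
  proof cases
    case 1
    show ?thesis
    proof (rule ccontr)
      assume large: "\<not> ?thesis"
      then have "5 * (5 + 1) \<le> 2 * card W" by simp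
      then obtain K where K: "K \<subseteq> W" "card K = 5" "clique E K"
        using clique_if_no_independent3[of E W 5, OF sym finW] 1 max' by (meson order_trans)
      then have "card (W - K) \<le> 10" using W finW by (intro card_off_clique5_le) auto
      then show False using K large finW by (simp add: card_Diff_subset finite_subset)
    qed
  next
    case 2
    then show ?thesis using card_le_if_independence_number3[OF W IW(1) _ IW(2)] max' by metis
  next
    case 3
    then show ?thesis using card_le_if_independence_number4[OF W IW(1) _ IW(2)] max' by metis
  next
    case 4
    then obtain J where J: "J \<subseteq> I" "card J = 5" using obtain_subset_with_card_n by metis
    then obtain a where a: "bij_betw a {..<5::nat} J"
      using ex_bij_betw_nat_finite[of J] by (metis card.infinite lessThan_atLeast0 zero_neq_numeral)
    then have a_mem: "j < 5 \<Longrightarrow> a j \<in> J" for j by (auto simp: bij_betw_def)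
    have False
    proof (rule no_independent5)
      show "inj_on a {..<5}" using a by (rule bij_betw_imp_inj_on)
      show "\<not> E (a j) (a k)" if "j < 5" "k < 5" for j k
        using a_mem[OF that(1)] a_mem[OF that(2)] J(1) IW(2) irrefl by (metis independent_def subsetD)
      show "a j < n" if "j < 5" for j using a_mem[OF that] J(1) IW(1) W by auto
    qed
    then show ?thesis ..
  qed
qed

end

subsection \<open>A graph on 15 vertices\<close>

text \<open>Vertices 0 to 4 are the clique and vertices 5 to 14 the pairs, hence the offset 5.
  Disjointness of pairs gives the Petersen graph as a Kneser graph.\<close>

definition pair_of :: "nat \<Rightarrow> nat set" where
  "pair_of k = [{0, 1}, {0, 2}, {0, 3}, {0, 4}, {1, 2}, {1, 3}, {1, 4}, {2, 3}, {2, 4}, {3, 4}] ! (k - 5)"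

definition K5_Petersen :: "nat \<Rightarrow> nat \<Rightarrow> bool" where
  "K5_Petersen i j \<longleftrightarrow>
    (if i < 5 then if j < 5 then i \<noteq> j else i \<in> pair_of j
     else if j < 5 then j \<in> pair_of i else pair_of i \<inter> pair_of j = {})"

text \<open>The four functionals express orthogonality to the sum-zero vectors on the clique. On
  their kernel the form becomes a sum of squares,
  \<open>5 * (2 * r + t)\<^sup>2 + s\<close>.\<close>

lemma K5_Petersen_form_positive:
  fixes x :: "nat \<Rightarrow> real"
  assumes nz: "\<exists>i<15. x i \<noteq> 0"
    and eq: "\<forall>k<4. (\<Sum>i<15. (of_bool (K5_Petersen (Suc k) i) - of_bool (K5_Petersen 0 i)) * x i) = 0"
  shows "0 < (\<Sum>k<15. \<Sum>l<15. of_bool (K5_Petersen k l) * x k * x l)"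
proof -
  have eqs: "x 1 = x 0 + (x 9 + x 10 + x 11) - (x 6 + x 7 + x 8)"
    "x 2 = x 0 + (x 9 + x 12 + x 13) - (x 5 + x 7 + x 8)"
    "x 3 = x 0 + (x 10 + x 12 + x 14) - (x 5 + x 6 + x 8)"
    "x 4 = x 0 + (x 11 + x 13 + x 14) - (x 5 + x 6 + x 7)"
    using eq[rule_format, of 0] eq[rule_format, of 1] eq[rule_format, of 2] eq[rule_format, of 3]
    by (simp_all add: lessThan_nat_numeral lessThan_Suc K5_Petersen_def pair_of_def)
  define t where "t = x 5 + x 6 + x 7 + x 8 + x 9 + x 10 + x 11 + x 12 + x 13 + x 14"
  \<comment> \<open>By \<open>eqs\<close>, this is for every clique vertex the same number: its
    entry minus the entries of the pairs containing it.\<close>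
  define r where "r = x 0 - (x 5 + x 6 + x 7 + x 8)"
  define s where "s = (x 5)\<^sup>2 + (x 6)\<^sup>2 + (x 7)\<^sup>2 + (x 8)\<^sup>2 + (x 9)\<^sup>2 + (x 10)\<^sup>2 + (x 11)\<^sup>2 + (x 12)\<^sup>2 + (x 13)\<^sup>2 + (x 14)\<^sup>2"
  define row where "row k = (\<Sum>l<15. of_bool (K5_Petersen k l) * x l)" for k
  have rows: "row 0 = x 1 + x 2 + x 3 + x 4 + x 5 + x 6 + x 7 + x 8"
    "row 1 = x 0 + x 2 + x 3 + x 4 + x 5 + x 9 + x 10 + x 11"
    "row 2 = x 0 + x 1 + x 3 + x 4 + x 6 + x 9 + x 12 + x 13"
    "row 3 = x 0 + x 1 + x 2 + x 4 + x 7 + x 10 + x 12 + x 14"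
    "row 4 = x 0 + x 1 + x 2 + x 3 + x 8 + x 11 + x 13 + x 14"
    "row 5 = x 0 + x 1 + x 12 + x 13 + x 14" "row 6 = x 0 + x 2 + x 10 + x 11 + x 14"
    "row 7 = x 0 + x 3 + x 9 + x 11 + x 13" "row 8 = x 0 + x 4 + x 9 + x 10 + x 12"
    "row 9 = x 1 + x 2 + x 7 + x 8 + x 14" "row 10 = x 1 + x 3 + x 6 + x 8 + x 13"
    "row 11 = x 1 + x 4 + x 6 + x 7 + x 12" "row 12 = x 2 + x 3 + x 5 + x 8 + x 11"
    "row 13 = x 2 + x 4 + x 5 + x 7 + x 10" "row 14 = x 3 + x 4 + x 5 + x 6 + x 9"
    by (simp_all add: row_def lessThan_nat_numeral lessThan_Suc K5_Petersen_def pair_of_def)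
  have clique_rows: "row 0 = 4 * r + 2 * t" "row 1 = 4 * r + 2 * t" "row 2 = 4 * r + 2 * t"
    "row 3 = 4 * r + 2 * t" "row 4 = 4 * r + 2 * t"
    unfolding rows eqs r_def t_def by simp_all
  \<comment> \<open>Summing over the pairs through each endpoint of a pair counts that pair twice
    and every other meeting pair once; the disjoint pairs complete the total
    \<open>t\<close>.\<close>
  have pair_rows: "row 5 = 2 * r + t + x 5" "row 6 = 2 * r + t + x 6" "row 7 = 2 * r + t + x 7"
    "row 8 = 2 * r + t + x 8" "row 9 = 2 * r + t + x 9" "row 10 = 2 * r + t + x 10"
    "row 11 = 2 * r + t + x 11" "row 12 = 2 * r + t + x 12" "row 13 = 2 * r + t + x 13"
    "row 14 = 2 * r + t + x 14"
    unfolding rows eqs r_def t_def by simp_all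
  have "(\<Sum>k<15. \<Sum>l<15. of_bool (K5_Petersen k l) * x k * x l) = (\<Sum>k<15. x k * row k)"
    unfolding row_def sum_distrib_left by (intro sum.cong refl) (simp only: mult.assoc mult.left_commute)
  also have "\<dots> = x 0 * row 0 + x 1 * row 1 + x 2 * row 2 + x 3 * row 3 + x 4 * row 4 + x 5 * row 5
    + x 6 * row 6 + x 7 * row 7 + x 8 * row 8 + x 9 * row 9 + x 10 * row 10 + x 11 * row 11
    + x 12 * row 12 + x 13 * row 13 + x 14 * row 14"
    by (simp add: lessThan_nat_numeral lessThan_Suc)
  also have "\<dots> = (4 * r + 2 * t) * (x 0 + x 1 + x 2 + x 3 + x 4) + (2 * r + t) * t + s"
  proof -
    have "(2 * r + t) * t = (2 * r + t) * x 5 + (2 * r + t) * x 6 + (2 * r + t) * x 7 + (2 * r + t) * x 8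
      + (2 * r + t) * x 9 + (2 * r + t) * x 10 + (2 * r + t) * x 11 + (2 * r + t) * x 12 + (2 * r + t) * x 13
      + (2 * r + t) * x 14"
      by (subst (2) t_def) (simp only: distrib_left)
    then show ?thesis
      unfolding clique_rows pair_rows s_def by (simp add: algebra_simps power2_eq_square)
  qed
  also have "x 0 + x 1 + x 2 + x 3 + x 4 = 5 * r + 2 * t"
    unfolding eqs r_def t_def by simp
  also have "(4 * r + 2 * t) * (5 * r + 2 * t) + (2 * r + t) * t + s = 5 * (2 * r + t)\<^sup>2 + s"
    by (simp add: algebra_simps power2_eq_square)
  finally have form: "(\<Sum>k<15. \<Sum>l<15. of_bool (K5_Petersen k l) * x k * x l) = 5 * (2 * r + t)\<^sup>2 + s" .
  have s: "s \<ge> 0" by (simp add: s_def)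
  have "5 * (2 * r + t)\<^sup>2 + s \<noteq> 0"
  proof
    assume zero: "5 * (2 * r + t)\<^sup>2 + s = 0"
    then have "s = 0" "(2 * r + t)\<^sup>2 = 0" using s zero_le_power2[of "2 * r + t"] by linarith+
    then have x: "x 5 = 0" "x 6 = 0" "x 7 = 0" "x 8 = 0" "x 9 = 0" "x 10 = 0" "x 11 = 0" "x 12 = 0" "x 13 = 0" "x 14 = 0"
      unfolding s_def by (simp_all add: add_nonneg_eq_0_iff)
    with \<open>(2 * r + t)\<^sup>2 = 0\<close> have "x 0 = 0" by (simp add: r_def t_def)
    with x eqs have "\<forall>i\<in>{..<15}. x i = 0" by (simp add: lessThan_nat_numeral lessThan_Suc)
    with nz show False by auto
  qed
  moreover have "5 * (2 * r + t)\<^sup>2 + s \<ge> 0" using s by simp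
  ultimately show ?thesis using form by linarith
qed

lemma K5_Petersen_symmetric: "K5_Petersen i j \<longleftrightarrow> K5_Petersen j i"
  by (auto simp: K5_Petersen_def)

text \<open>The bound matters: beyond 14 the list lookup in \<open>pair_of\<close> is
  unspecified.\<close>

lemma K5_Petersen_irreflexive:
  assumes "i < 15"
  shows "\<not> K5_Petersen i i"
proof -
  have "\<forall>i\<in>{..<15}. \<not> K5_Petersen i i"
    by (simp add: lessThan_nat_numeral lessThan_Suc K5_Petersen_def pair_of_def)
  then show ?thesis using assms by simp
qed

subsection \<open>The value of NPO(5)\<close>

lemma adj_mat_symmetric:
  assumes "simple_graph n E"
  shows "adj_mat n E \<in> carrier_mat n n" "transpose_mat (adj_mat n E) = adj_mat n E"
  using assms by (auto simp: adj_mat_def simple_graph_def intro!: eq_matI)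

lemma adj_mat_form:
  "(\<Sum>k<n. \<Sum>l<n. adj_mat n E $$ (k, l) * x k * x l) = adj_form n E x x"
  unfolding adj_form_def by (intro sum.cong refl) (simp add: adj_mat_def)

lemma num_nonpos_eigs_adj_mat_ge_5:
  assumes "simple_graph m E" "m \<ge> 16"
  shows "5 \<le> num_nonpos_eigs (adj_mat m E)"
proof (rule ccontr)
  assume "\<not> ?thesis"
  then have "num_nonpos_eigs (adj_mat m E) \<le> 4" by simp
  then obtain f where f: "\<And>x. \<exists>i<m. x i \<noteq> 0 \<Longrightarrow> \<forall>k<4::nat. (\<Sum>i<m. f k i * x i) = 0 \<Longrightarrow> 0 < adj_form m E x x"
    unfolding num_nonpos_eigs_le_iff[OF adj_mat_symmetric[OF assms(1)]] adj_mat_form by blast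
  \<comment> \<open>\<open>simple_graph\<close> constrains \<open>E\<close> only below
    \<open>m\<close>; cutting off the rest gives the unbounded laws of the locale and leaves the
    form unchanged.\<close>
  define E' where "E' i j \<longleftrightarrow> i < m \<and> j < m \<and> E i j" for i j
  have "adj_form m E' x x = adj_form m E x x" for x
    unfolding adj_form_def by (intro sum.cong refl) (simp add: E'_def)
  then interpret few_nonpos_graph m E' f
    using assms(1) f by unfold_locales (auto simp: E'_def simple_graph_def)
  have "card {..<m} \<le> 15" by (rule card_vertices_le) simp
  with assms(2) show False by simp
qed

theorem mainTheorem10:
  shows "NPO 5 = 16"
  unfolding NPO_def
proof (rule Least_equality)
  show "\<forall>m\<ge>16. \<forall>E. simple_graph m E \<longrightarrow> 5 \<le> num_nonpos_eigs (adj_mat m E)"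
    using num_nonpos_eigs_adj_mat_ge_5 by blast
next
  fix n assume n: "\<forall>m\<ge>n. \<forall>E. simple_graph m E \<longrightarrow> 5 \<le> num_nonpos_eigs (adj_mat m E)"
  have graph: "simple_graph 15 K5_Petersen"
    using K5_Petersen_symmetric K5_Petersen_irreflexive by (simp add: simple_graph_def)
  have "num_nonpos_eigs (adj_mat 15 K5_Petersen) \<le> 4"
    unfolding num_nonpos_eigs_le_iff[OF adj_mat_symmetric[OF graph]] adj_mat_form adj_form_def
    using K5_Petersen_form_positive
    by (intro exI[of _ "\<lambda>k i. of_bool (K5_Petersen (Suc k) i) - of_bool (K5_Petersen 0 i)"]) blast
  moreover have "5 \<le> num_nonpos_eigs (adj_mat 15 K5_Petersen)" if "n \<le> 15"
    using n[rule_format, OF that graph] .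
  ultimately show "16 \<le> n" by linarith
qed

end
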